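(* Let $A$ be a Marot ring which is an N-ring. The following assertions are equivalent. (i) $A$ is an SP-ring. (ii) Every regular maximal ideal of $A$ contains some regular finitely generated radical ideal. (iii) The radical of every regular finitely generated ideal of $A$ is finitely generated. (iv) For every $x\in \mathrm{Reg}(A)$, $xA$ is a product of radical ideals. (v) For every $x\in \mathrm{Reg}(A)$ and $n\geq 1$, the set $V_n(x)$ is closed in $\mathrm{Spec}(A)$, and (for every $x\in\mathrm{Reg}(A)$) $V_m(x)$ is empty for some $m\geq 1$. (vi) For every regular proper ideal $I$ of $A$ and $n\geq 1$, the set $V_n(I)$ is closed in $\mathrm{Spec}(A)$, and (for every such $I$) $V_m(I)$ is empty for some $m\geq 1$. (vii) Every regular proper ideal $I$ of $A$ can be factorized as $I=J_1J_2\cdots J_n$ with radical ideals $J_1\subseteq J_2\subseteq \cdots \subseteq J_n$. (viii) Every regular proper ideal $I$ of $A$ can be factorized uniquely as $I=J_1J_2\cdots J_n$ with proper radical ideals $J_1\subseteq J_2\subseteq \cdots \subseteq J_n$.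
   Context: All rings are commutative with $1$. For a ring $A$, $\mathrm{Reg}(A)$ is the set of regular elements (non-zerodivisors) of $A$, and a regular ideal is an ideal containing a regular element. A Marot ring is a ring in which every regular ideal is generated by regular elements. An ideal $I$ is radical if $\sqrt{I}=I$ (the whole ring counts as a radical ideal). An SP-ring is a ring in which every regular ideal is a (finite) product of radical ideals. For a prime ideal $P$ of $A$, $A_{(P)}$ denotes the regular localization $A_T$, where $T=\mathrm{Reg}(A)\cap(A\setminus P)$; it is a subring of the total quotient ring $K=A_{\mathrm{Reg}(A)}$. A discrete rank one Manis valuation ring is a ring $V$ with total quotient ring $K$ for which there is a surjective map $v:K\to\mathbb{Z}\cup\{\infty\}$ with $v(1)=0$, $v(0)=\infty$, $v(xy)=v(x)+v(y)$, $v(x+y)\ge\min\{v(x),v(y)\}$ for all $x,y\in K$, and $V=\{x\in K: v(x)\ge 0\}$. An N-ring is a ring $A$ such that $A_{(M)}$ is a discrete rank one Manis valuation ring for each regular maximal ideal $M$ of $A$. For a nonempty subset $E$ of $A$ and $n\ge 1$, $V_n(E)=\{P\in \mathrm{Spec}(A): E\subseteq P^n\}$; $V_n(x)$ means $V_n(\{x\})$. $\mathrm{Spec}(A)$ carries the Zariski topology. *)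

theory Defs
  imports
    "HOL-Algebra.Ideal_Product"
    "HOL-Analysis.Abstract_Topology"
    "HOL-Library.Extended"
begin

section \<open>Regular elements and regular ideals\<close>

definition Reg :: "('a, 'm) ring_scheme \<Rightarrow> 'a set"
  where "Reg R = {r \<in> carrier R. \<forall>x \<in> carrier R. r \<otimes>\<^bsub>R\<^esub> x = \<zero>\<^bsub>R\<^esub> \<longrightarrow> x = \<zero>\<^bsub>R\<^esub>}"

definition regular_ideal :: "'a set \<Rightarrow> ('a, 'm) ring_scheme \<Rightarrow> bool"
  where "regular_ideal I R \<longleftrightarrow> ideal I R \<and> I \<inter> Reg R \<noteq> {}"

definition fin_gen_ideal :: "'a set \<Rightarrow> ('a, 'm) ring_scheme \<Rightarrow> bool"
  where "fin_gen_ideal I R \<longleftrightarrow> (\<exists>S \<subseteq> carrier R. finite S \<and> I = Idl\<^bsub>R\<^esub> S)"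

locale marot_ring = cring +
  assumes regular_generators: "regular_ideal I R \<Longrightarrow> \<exists>S \<subseteq> Reg R. I = Idl S"

section \<open>Radical ideals and products of ideals\<close>

definition ideal_radical :: "('a, 'm) ring_scheme \<Rightarrow> 'a set \<Rightarrow> 'a set"
  where "ideal_radical R I = {x \<in> carrier R. \<exists>n::nat. n \<ge> 1 \<and> x [^]\<^bsub>R\<^esub> n \<in> I}"

definition radical_ideal :: "'a set \<Rightarrow> ('a, 'm) ring_scheme \<Rightarrow> bool"
  where "radical_ideal I R \<longleftrightarrow> ideal I R \<and> ideal_radical R I = I"

definition ideal_list_prod :: "('a, 'm) ring_scheme \<Rightarrow> 'a set list \<Rightarrow> 'a set"
  where "ideal_list_prod R Js = foldr (ideal_prod R) Js (carrier R)"

definition product_of_radical_ideals :: "'a set \<Rightarrow> ('a, 'm) ring_scheme \<Rightarrow> bool"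
  where "product_of_radical_ideals I R \<longleftrightarrow>
    (\<exists>Js. Js \<noteq> [] \<and> (\<forall>J \<in> set Js. radical_ideal J R) \<and> I = ideal_list_prod R Js)"

locale SP_ring = cring +
  assumes regular_factorization: "regular_ideal I R \<Longrightarrow> product_of_radical_ideals I R"

section \<open>The total quotient ring\<close>

text \<open>The fraction \<open>a / s\<close> is the set of all pairs representing it. Denominators are regular,
  so \<open>a / s = b / t\<close> amounts to \<open>a t = b s\<close>.\<close>

definition fraction :: "('a, 'm) ring_scheme \<Rightarrow> 'a \<Rightarrow> 'a \<Rightarrow> ('a \<times> 'a) set"
  where "fraction R a s = {(b, t). b \<in> carrier R \<and> t \<in> Reg R \<and> a \<otimes>\<^bsub>R\<^esub> t = b \<otimes>\<^bsub>R\<^esub> s}"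

definition total_quotient_ring :: "('a, 'm) ring_scheme \<Rightarrow> ('a \<times> 'a) set ring"
  where "total_quotient_ring R =
    \<lparr> carrier = {fraction R a s | a s. a \<in> carrier R \<and> s \<in> Reg R},
      monoid.mult = (\<lambda>p q. \<Union>(a, s) \<in> p. \<Union>(b, t) \<in> q. fraction R (a \<otimes>\<^bsub>R\<^esub> b) (s \<otimes>\<^bsub>R\<^esub> t)),
      one = fraction R \<one>\<^bsub>R\<^esub> \<one>\<^bsub>R\<^esub>,
      zero = fraction R \<zero>\<^bsub>R\<^esub> \<one>\<^bsub>R\<^esub>,
      add = (\<lambda>p q. \<Union>(a, s) \<in> p. \<Union>(b, t) \<in> q.
               fraction R (a \<otimes>\<^bsub>R\<^esub> t \<oplus>\<^bsub>R\<^esub> b \<otimes>\<^bsub>R\<^esub> s) (s \<otimes>\<^bsub>R\<^esub> t)) \<rparr>"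

lemma UN_pairs_const:
  assumes "(a, s) \<in> p" "(b, t) \<in> q"
    and eq: "\<And>a s b t. (a, s) \<in> p \<Longrightarrow> (b, t) \<in> q \<Longrightarrow> F a s b t = C"
  shows "(\<Union>(a, s) \<in> p. \<Union>(b, t) \<in> q. F a s b t) = C"
proof -
  have "(\<Union>(b, t) \<in> q. F a' s' b t) = C" if "(a', s') \<in> p" for a' s'
  proof -
    have "(\<lambda>(b, t). F a' s' b t) ` q = {C}"
      using assms(2) eq[OF that] by force
    then show ?thesis by simp
  qed
  then have "(\<lambda>(a, s). \<Union>(b, t) \<in> q. F a s b t) ` p = {C}"
    using assms(1) by force
  then show ?thesis by simp
qed

context cring
begin

lemma Reg_closed: "s \<in> Reg R \<Longrightarrow> s \<in> carrier R"
  by (simp add: Reg_def)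

lemma one_Reg: "\<one> \<in> Reg R"
  by (simp add: Reg_def)

lemma Reg_mult:
  assumes s: "s \<in> Reg R" and t: "t \<in> Reg R"
  shows "s \<otimes> t \<in> Reg R"
proof -
  note cl = s[THEN Reg_closed] t[THEN Reg_closed]
  have "x = \<zero>" if x: "x \<in> carrier R" and 0: "(s \<otimes> t) \<otimes> x = \<zero>" for x
  proof -
    have "s \<otimes> (t \<otimes> x) = \<zero>" using 0 m_assoc[OF cl x] by simp
    then have "t \<otimes> x = \<zero>" using s m_closed[OF cl(2) x] unfolding Reg_def by blast
    then show ?thesis using t x unfolding Reg_def by blast
  qed
  then show ?thesis using m_closed[OF cl] unfolding Reg_def by blast
qed

lemma Reg_cancel:
  assumes "s \<in> Reg R" "x \<in> carrier R" "y \<in> carrier R" "s \<otimes> x = s \<otimes> y"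
  shows "x = y"
proof -
  have s: "s \<in> carrier R" using assms(1) by (rule Reg_closed)
  have "s \<otimes> (x \<ominus> y) = s \<otimes> x \<ominus> s \<otimes> y"
    using assms(2,3) s by algebra
  also have "\<dots> = \<zero>" using assms(3,4) s by (simp add: r_neg minus_eq)
  finally have "x \<ominus> y = \<zero>"
    using assms(1) minus_closed[OF assms(2,3)] unfolding Reg_def by blast
  then show ?thesis using assms(2,3) by (metis add.inv_closed minus_equality minus_eq minus_minus)
qed

lemma fraction_self: "a \<in> carrier R \<Longrightarrow> s \<in> Reg R \<Longrightarrow> (a, s) \<in> fraction R a s"
  by (simp add: fraction_def)

lemma fraction_trans:
  assumes "a \<in> carrier R" "b \<in> carrier R" "c \<in> carrier R"
    and "s \<in> Reg R" "t \<in> Reg R" "u \<in> Reg R"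
    and "a \<otimes> t = b \<otimes> s" "b \<otimes> u = c \<otimes> t"
  shows "a \<otimes> u = c \<otimes> s"
proof (rule Reg_cancel[OF assms(5)])
  have cl: "s \<in> carrier R" "t \<in> carrier R" "u \<in> carrier R"
    using assms by (auto intro: Reg_closed)
  have "t \<otimes> (a \<otimes> u) = (a \<otimes> t) \<otimes> u" using assms(1-3) cl by algebra
  also have "\<dots> = (b \<otimes> u) \<otimes> s" unfolding assms(7) using assms(1-3) cl by algebra
  also have "\<dots> = t \<otimes> (c \<otimes> s)" unfolding assms(8) using assms(1-3) cl by algebra
  finally show "t \<otimes> (a \<otimes> u) = t \<otimes> (c \<otimes> s)" .
qed (use assms in \<open>auto intro: Reg_closed\<close>)

lemma fraction_subset:
  assumes "a \<in> carrier R" "b \<in> carrier R" "s \<in> Reg R" "t \<in> Reg R" "a \<otimes> t = b \<otimes> s"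
  shows "fraction R a s \<subseteq> fraction R b t"
proof
  fix x assume "x \<in> fraction R a s"
  then obtain c u where x: "x = (c, u)" and *: "c \<in> carrier R" "u \<in> Reg R" "a \<otimes> u = c \<otimes> s"
    unfolding fraction_def by blast
  have "b \<otimes> u = c \<otimes> t"
    by (rule fraction_trans[OF assms(2,1) *(1) assms(4,3) *(2) assms(5)[symmetric] *(3)])
  then show "x \<in> fraction R b t" unfolding fraction_def x using *(1,2) by blast
qed

lemma fraction_eq_iff:
  assumes "a \<in> carrier R" "b \<in> carrier R" "s \<in> Reg R" "t \<in> Reg R"
  shows "fraction R a s = fraction R b t \<longleftrightarrow> a \<otimes> t = b \<otimes> s"
proof
  assume "fraction R a s = fraction R b t"
  then have "(b, t) \<in> fraction R a s" using fraction_self assms by simp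
  then show "a \<otimes> t = b \<otimes> s" by (simp add: fraction_def)
next
  assume eq: "a \<otimes> t = b \<otimes> s"
  show "fraction R a s = fraction R b t"
    using fraction_subset[OF assms eq] fraction_subset[OF assms(2,1,4,3) eq[symmetric]]
    by (rule subset_antisym)
qed

lemma fraction_mult:
  assumes "a \<in> carrier R" "b \<in> carrier R" "s \<in> Reg R" "t \<in> Reg R"
  shows "fraction R a s \<otimes>\<^bsub>total_quotient_ring R\<^esub> fraction R b t = fraction R (a \<otimes> b) (s \<otimes> t)"
proof -
  have eq: "fraction R (a' \<otimes> b') (s' \<otimes> t') = fraction R (a \<otimes> b) (s \<otimes> t)"
    if "(a', s') \<in> fraction R a s" "(b', t') \<in> fraction R b t" for a' s' b' t'
  proof -
    have h: "a' \<in> carrier R" "b' \<in> carrier R" "s' \<in> Reg R" "t' \<in> Reg R"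
      "a \<otimes> s' = a' \<otimes> s" "b \<otimes> t' = b' \<otimes> t"
      using that unfolding fraction_def by blast+
    have cl: "s \<in> carrier R" "t \<in> carrier R" "s' \<in> carrier R" "t' \<in> carrier R"
      using assms h by (auto intro: Reg_closed)
    have "(a' \<otimes> b') \<otimes> (s \<otimes> t) = (a' \<otimes> s) \<otimes> (b' \<otimes> t)"
      using assms(1,2) h(1,2) cl by algebra
    also have "\<dots> = (a \<otimes> s') \<otimes> (b \<otimes> t')" by (simp add: h)
    also have "\<dots> = (a \<otimes> b) \<otimes> (s' \<otimes> t')" using assms(1,2) h(1,2) cl by algebra
    finally have *: "(a' \<otimes> b') \<otimes> (s \<otimes> t) = (a \<otimes> b) \<otimes> (s' \<otimes> t')" .
    show ?thesis
      by (rule fraction_eq_iff[THEN iffD2, OF _ _ _ _ *])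
        (intro m_closed Reg_mult assms h(1-4))+
  qed
  show ?thesis
    unfolding total_quotient_ring_def monoid.select_convs ring.select_convs
    by (rule UN_pairs_const[OF fraction_self[OF assms(1,3)] fraction_self[OF assms(2,4)] eq])
qed

lemma fraction_add:
  assumes "a \<in> carrier R" "b \<in> carrier R" "s \<in> Reg R" "t \<in> Reg R"
  shows "fraction R a s \<oplus>\<^bsub>total_quotient_ring R\<^esub> fraction R b t
    = fraction R (a \<otimes> t \<oplus> b \<otimes> s) (s \<otimes> t)"
proof -
  have eq: "fraction R (a' \<otimes> t' \<oplus> b' \<otimes> s') (s' \<otimes> t') = fraction R (a \<otimes> t \<oplus> b \<otimes> s) (s \<otimes> t)"
    if "(a', s') \<in> fraction R a s" "(b', t') \<in> fraction R b t" for a' s' b' t'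
  proof -
    have h: "a' \<in> carrier R" "b' \<in> carrier R" "s' \<in> Reg R" "t' \<in> Reg R"
      "a \<otimes> s' = a' \<otimes> s" "b \<otimes> t' = b' \<otimes> t"
      using that unfolding fraction_def by blast+
    have cl: "s \<in> carrier R" "t \<in> carrier R" "s' \<in> carrier R" "t' \<in> carrier R"
      using assms h by (auto intro: Reg_closed)
    have "(a' \<otimes> t' \<oplus> b' \<otimes> s') \<otimes> (s \<otimes> t)
        = (a' \<otimes> s) \<otimes> (t \<otimes> t') \<oplus> (b' \<otimes> t) \<otimes> (s \<otimes> s')"
      using assms(1,2) h(1,2) cl by algebra
    also have "\<dots> = (a \<otimes> s') \<otimes> (t \<otimes> t') \<oplus> (b \<otimes> t') \<otimes> (s \<otimes> s')" by (simp add: h)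
    also have "\<dots> = (a \<otimes> t \<oplus> b \<otimes> s) \<otimes> (s' \<otimes> t')" using assms(1,2) h(1,2) cl by algebra
    finally have *: "(a' \<otimes> t' \<oplus> b' \<otimes> s') \<otimes> (s \<otimes> t) = (a \<otimes> t \<oplus> b \<otimes> s) \<otimes> (s' \<otimes> t')" .
    show ?thesis
      by (rule fraction_eq_iff[THEN iffD2, OF _ _ _ _ *])
        (intro a_closed m_closed Reg_mult assms h(1-4) cl)+
  qed
  show ?thesis
    unfolding total_quotient_ring_def monoid.select_convs ring.select_convs
    by (rule UN_pairs_const[OF fraction_self[OF assms(1,3)] fraction_self[OF assms(2,4)] eq])
qed

lemma fraction_closed:
  "a \<in> carrier R \<Longrightarrow> s \<in> Reg R \<Longrightarrow> fraction R a s \<in> carrier (total_quotient_ring R)"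
  unfolding total_quotient_ring_def partial_object.select_convs by blast

lemma fraction_cases:
  assumes "p \<in> carrier (total_quotient_ring R)"
  obtains a s where "a \<in> carrier R" "s \<in> Reg R" "p = fraction R a s"
  using assms unfolding total_quotient_ring_def partial_object.select_convs by blast

lemma total_quotient_ring_cring: "cring (total_quotient_ring R)"
proof -
  let ?K = "total_quotient_ring R"
  have one: "\<one>\<^bsub>?K\<^esub> = fraction R \<one> \<one>" and zero: "\<zero>\<^bsub>?K\<^esub> = fraction R \<zero> \<one>"
    by (simp_all add: total_quotient_ring_def)
  note ops = fraction_mult fraction_add fraction_closed one zero
  note cl = Reg_mult one_Reg Reg_closed
  show ?thesis
  proof (intro cringI abelian_groupI comm_monoidI)
    fix p q assume "p \<in> carrier ?K" "q \<in> carrier ?K"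
    then obtain a s b t where *: "a \<in> carrier R" "s \<in> Reg R" "p = fraction R a s"
      "b \<in> carrier R" "t \<in> Reg R" "q = fraction R b t" by (elim fraction_cases)
    then have c: "s \<in> carrier R" "t \<in> carrier R" by (auto intro: Reg_closed)
    show "p \<oplus>\<^bsub>?K\<^esub> q \<in> carrier ?K" "p \<otimes>\<^bsub>?K\<^esub> q \<in> carrier ?K"
      using * c by (auto simp: ops cl)
    show "p \<oplus>\<^bsub>?K\<^esub> q = q \<oplus>\<^bsub>?K\<^esub> p"
      using * c by (simp add: ops cl m_comm a_comm)
    show "p \<otimes>\<^bsub>?K\<^esub> q = q \<otimes>\<^bsub>?K\<^esub> p"
      using * c by (simp add: ops cl m_comm)
  next
    fix p q r assume "p \<in> carrier ?K" "q \<in> carrier ?K" "r \<in> carrier ?K"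
    then obtain a s b t d u where *: "a \<in> carrier R" "s \<in> Reg R" "p = fraction R a s"
      "b \<in> carrier R" "t \<in> Reg R" "q = fraction R b t"
      "d \<in> carrier R" "u \<in> Reg R" "r = fraction R d u" by (elim fraction_cases)
    then have c: "s \<in> carrier R" "t \<in> carrier R" "u \<in> carrier R" by (auto intro: Reg_closed)
    show "(p \<otimes>\<^bsub>?K\<^esub> q) \<otimes>\<^bsub>?K\<^esub> r = p \<otimes>\<^bsub>?K\<^esub> (q \<otimes>\<^bsub>?K\<^esub> r)"
      using * c by (simp add: ops cl m_assoc)
    have "((a \<otimes> t \<oplus> b \<otimes> s) \<otimes> u \<oplus> d \<otimes> (s \<otimes> t)) \<otimes> (s \<otimes> (t \<otimes> u))
        = (a \<otimes> (t \<otimes> u) \<oplus> (b \<otimes> u \<oplus> d \<otimes> t) \<otimes> s) \<otimes> ((s \<otimes> t) \<otimes> u)"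
      using *(1,4,7) c by algebra
    then show "(p \<oplus>\<^bsub>?K\<^esub> q) \<oplus>\<^bsub>?K\<^esub> r = p \<oplus>\<^bsub>?K\<^esub> (q \<oplus>\<^bsub>?K\<^esub> r)"
      using * c by (simp add: ops cl fraction_eq_iff)
    have "((a \<otimes> t \<oplus> b \<otimes> s) \<otimes> d) \<otimes> ((s \<otimes> u) \<otimes> (t \<otimes> u))
        = ((a \<otimes> d) \<otimes> (t \<otimes> u) \<oplus> (b \<otimes> d) \<otimes> (s \<otimes> u)) \<otimes> ((s \<otimes> t) \<otimes> u)"
      using *(1,4,7) c by algebra
    then show "(p \<oplus>\<^bsub>?K\<^esub> q) \<otimes>\<^bsub>?K\<^esub> r = p \<otimes>\<^bsub>?K\<^esub> r \<oplus>\<^bsub>?K\<^esub> q \<otimes>\<^bsub>?K\<^esub> r"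
      using * c by (simp add: ops cl fraction_eq_iff)
  next
    fix p assume "p \<in> carrier ?K"
    then obtain a s where *: "a \<in> carrier R" "s \<in> Reg R" "p = fraction R a s"
      by (elim fraction_cases)
    then have c: "s \<in> carrier R" by (auto intro: Reg_closed)
    show "\<one>\<^bsub>?K\<^esub> \<otimes>\<^bsub>?K\<^esub> p = p" "\<zero>\<^bsub>?K\<^esub> \<oplus>\<^bsub>?K\<^esub> p = p"
      using * c by (simp_all add: ops cl)
    have "(\<ominus> a \<otimes> s \<oplus> a \<otimes> s) \<otimes> \<one> = \<zero> \<otimes> (s \<otimes> s)" using *(1) c by algebra
    then have "fraction R (\<ominus> a) s \<oplus>\<^bsub>?K\<^esub> p = \<zero>\<^bsub>?K\<^esub>"
      using * c by (simp add: ops cl fraction_eq_iff)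
    then show "\<exists>q \<in> carrier ?K. q \<oplus>\<^bsub>?K\<^esub> p = \<zero>\<^bsub>?K\<^esub>"
      using * by (blast intro: fraction_closed a_inv_closed)
  qed (auto simp: ops cl)
qed

end

section \<open>Regular localizations, discrete rank one Manis valuation rings, N-rings\<close>

text \<open>The regular localization at \<open>P\<close>, as a subring of the total quotient ring.\<close>

definition reg_localization :: "('a, 'm) ring_scheme \<Rightarrow> 'a set \<Rightarrow> ('a \<times> 'a) set ring"
  where "reg_localization R P =
    (total_quotient_ring R)
      \<lparr>carrier := {fraction R a s | a s. a \<in> carrier R \<and> s \<in> Reg R \<inter> (carrier R - P)}\<rparr>"

text \<open>The type \<^typ>\<open>int extended\<close> also has the value \<^const>\<open>Minf\<close>, so the surjectivity condition
  below says at the same time that the values lie in the integers with \<^const>\<open>Pinf\<close> adjoined. In the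
  last condition the ring is identified with its image \<open>{a / 1}\<close> in its total quotient ring.\<close>

locale discrete_rank_one_Manis_valuation_ring = cring +
  assumes ex_valuation:
    "\<exists>v :: ('a \<times> 'a) set \<Rightarrow> int extended.
      let K = total_quotient_ring R in
        v ` carrier K = range Fin \<union> {Pinf} \<and>
        v \<one>\<^bsub>K\<^esub> = Fin 0 \<and> v \<zero>\<^bsub>K\<^esub> = Pinf \<and>
        (\<forall>x \<in> carrier K. \<forall>y \<in> carrier K. v (x \<otimes>\<^bsub>K\<^esub> y) = v x + v y) \<and>
        (\<forall>x \<in> carrier K. \<forall>y \<in> carrier K. v (x \<oplus>\<^bsub>K\<^esub> y) \<ge> min (v x) (v y)) \<and>
        (\<lambda>a. fraction R a \<one>) ` carrier R = {x \<in> carrier K. v x \<ge> Fin 0}"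

locale N_ring = cring +
  assumes localization_Manis:
    "maximalideal M R \<Longrightarrow> regular_ideal M R \<Longrightarrow>
      discrete_rank_one_Manis_valuation_ring (reg_localization R M)"

section \<open>The prime spectrum\<close>

definition Spec :: "('a, 'm) ring_scheme \<Rightarrow> 'a set set"
  where "Spec R = {P. primeideal P R}"

definition Zariski :: "('a, 'm) ring_scheme \<Rightarrow> 'a set topology"
  where "Zariski R = topology (\<lambda>U. \<exists>E \<subseteq> carrier R. U = {P \<in> Spec R. \<not> E \<subseteq> P})"

lemma istopology_Zariski:
  "istopology (\<lambda>U. \<exists>E \<subseteq> carrier R. U = {P \<in> Spec R. \<not> E \<subseteq> P})"
  unfolding istopology_def
proof (intro conjI allI impI)
  fix S T
  assume "\<exists>E \<subseteq> carrier R. S = {P \<in> Spec R. \<not> E \<subseteq> P}"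
    and "\<exists>E \<subseteq> carrier R. T = {P \<in> Spec R. \<not> E \<subseteq> P}"
  then obtain E F where EF: "E \<subseteq> carrier R" "S = {P \<in> Spec R. \<not> E \<subseteq> P}"
    "F \<subseteq> carrier R" "T = {P \<in> Spec R. \<not> F \<subseteq> P}" by blast
  show "\<exists>E \<subseteq> carrier R. S \<inter> T = {P \<in> Spec R. \<not> E \<subseteq> P}"
  proof (cases "\<exists>P. primeideal P R")
    case False
    then show ?thesis using EF by (auto simp: Spec_def)
  next
    case True
    then interpret cring R by (auto simp: primeideal_def)
    define G where "G = {e \<otimes>\<^bsub>R\<^esub> f | e f. e \<in> E \<and> f \<in> F}"
    have "\<not> G \<subseteq> P \<longleftrightarrow> \<not> E \<subseteq> P \<and> \<not> F \<subseteq> P" if "P \<in> Spec R" for P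
    proof -
      interpret primeideal P R using that by (simp add: Spec_def)
      have "e \<in> P \<or> f \<in> P" if "e \<otimes>\<^bsub>R\<^esub> f \<in> P" "e \<in> E" "f \<in> F" for e f
        using I_prime that EF by blast
      moreover have "e \<otimes>\<^bsub>R\<^esub> f \<in> P" if "e \<in> E" "f \<in> F" "e \<in> P \<or> f \<in> P" for e f
        using that EF I_l_closed I_r_closed by blast
      ultimately show ?thesis unfolding G_def by blast
    qed
    moreover have "G \<subseteq> carrier R" using EF by (auto simp: G_def)
    ultimately show ?thesis using EF by (intro exI[of _ G]) auto
  qed
next
  fix \<U>
  assume "\<forall>U \<in> \<U>. \<exists>E \<subseteq> carrier R. U = {P \<in> Spec R. \<not> E \<subseteq> P}"
  then obtain E where E: "\<And>U. U \<in> \<U> \<Longrightarrow> E U \<subseteq> carrier R"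
    "\<And>U. U \<in> \<U> \<Longrightarrow> U = {P \<in> Spec R. \<not> E U \<subseteq> P}" by metis
  have "\<Union>\<U> = {P \<in> Spec R. \<not> (\<Union>U \<in> \<U>. E U) \<subseteq> P}"
    using E(2) by blast
  then show "\<exists>E \<subseteq> carrier R. \<Union>\<U> = {P \<in> Spec R. \<not> E \<subseteq> P}"
    using E(1) by (metis UN_least)
qed

lemma openin_Zariski:
  "openin (Zariski R) U \<longleftrightarrow> (\<exists>E \<subseteq> carrier R. U = {P \<in> Spec R. \<not> E \<subseteq> P})"
  by (simp add: Zariski_def istopology_Zariski)

lemma topspace_Zariski: "topspace (Zariski R) = Spec R"
proof
  show "topspace (Zariski R) \<subseteq> Spec R"
    by (auto simp: topspace_def openin_Zariski)
  have "{P \<in> Spec R. \<not> carrier R \<subseteq> P} = Spec R"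
    by (auto simp: Spec_def dest: primeideal.I_notcarr ideal.Icarr[OF primeideal.axioms(1)])
  then have "openin (Zariski R) (Spec R)"
    unfolding openin_Zariski by blast
  then show "Spec R \<subseteq> topspace (Zariski R)" by (rule openin_subset)
qed

lemma closedin_Zariski:
  "closedin (Zariski R) C \<longleftrightarrow> (\<exists>E \<subseteq> carrier R. C = {P \<in> Spec R. E \<subseteq> P})"
proof -
  have "C \<subseteq> Spec R \<and> Spec R - C = {P \<in> Spec R. \<not> E \<subseteq> P} \<longleftrightarrow> C = {P \<in> Spec R. E \<subseteq> P}" for E
    by blast
  then show ?thesis
    unfolding closedin_def topspace_Zariski openin_Zariski by (metis (no_types, lifting))
qed

text \<open>Powers of ideals are taken in the multiplicative monoid of ideals \<^const>\<open>ideals_set\<close>.\<close>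

definition V_pow :: "('a, 'm) ring_scheme \<Rightarrow> nat \<Rightarrow> 'a set \<Rightarrow> 'a set set"
  where "V_pow R n E = {P \<in> Spec R. E \<subseteq> P [^]\<^bsub>ideals_set R\<^esub> n}"

section \<open>Equivalence of a list of assertions\<close>

definition all_equivalent :: "bool list \<Rightarrow> bool"
  where "all_equivalent ps \<longleftrightarrow> (\<forall>p \<in> set ps. \<forall>q \<in> set ps. p \<longleftrightarrow> q)"

end

theory Submission
  imports Defs "HOL-Library.Extended_Nat"
begin

text \<open>
Each regular maximal ideal \<open>M\<close> carries a discrete valuation \<open>v\<^sub>M\<close>, the restriction to the ring of the
Manis valuation of the regular localization at \<open>M\<close>. In a Marot ring it behaves as over a Dedekind
domain: \<open>M\<close> is the set where \<open>v\<^sub>M\<close> is positive, and some regular element has value 1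
(\<open>ex_valuation_at\<close>). Put \<open>ord M I = min v\<^sub>M(I)\<close>. For regular \<open>I\<close> the minimum is attained at a regular
element, again by the Marot property, and this makes membership local: \<open>I\<close> consists of the elements
whose value at every \<open>M\<close> is at least \<open>ord M I\<close> (\<open>regular_memI\<close>). So a regular ideal is the same thing
as its order function, orders add under products, regular primes are maximal, and the set
\<open>V\<^sub>n(I)\<close>, for \<open>n \<ge> 1\<close>, consists of the \<open>M\<close> with \<open>ord M I \<ge> n\<close> (\<open>V_pow_eq\<close>).

A regular radical ideal has order 1 at the \<open>M\<close> that contain it and order 0 elsewhere, so it is
determined by a closed set, and a factorization of \<open>I\<close> into radical ideals writes its order function
as a finite sum of indicator functions of closed sets. For such a sum \<open>V\<^sub>n(I)\<close> is the set of points
lying in at least \<open>n\<close> of these closed sets, hence closed, and empty once \<open>n\<close> exceeds the number of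
factors (\<open>closed_V_pow_list_prod\<close>, \<open>V_pow_list_prod_empty\<close>). Conversely the order function is the sum of
the indicators of the superlevel sets \<open>V\<^sub>1(I) \<supseteq> V\<^sub>2(I) \<supseteq> \<dots>\<close>; if these are closed and finally empty, the
radical ideals they define form an ascending chain with product \<open>I\<close>
(\<open>closed_V_pow_imp_chain_factorization\<close>). An integer-valued function has only one decomposition into
indicators of nonempty decreasing sets, whence uniqueness (\<open>chain_factorization_unique\<close>). So already
the factorization of the ideals \<open>xA\<close> with \<open>x\<close> regular makes the sets \<open>V\<^sub>n(x)\<close> closed and finally empty;
this passes to the sets \<open>V\<^sub>n(I)\<close>, since a regular ideal is generated by its regular elements, and gives
the unique factorization into chains. From there the way back to the ideals \<open>xA\<close> is immediate.

For the two statements on finite generation: a regular finitely generated ideal \<open>I\<close> is invertible,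
factors of invertible ideals are invertible, invertible ideals are finitely generated, and the first
factor of an ascending chain with product \<open>I\<close> is the radical of \<open>I\<close>. So factorizations into chains
make the radical of \<open>I\<close> finitely generated (\<open>radical_fin_gen\<close>), and the radical of \<open>rA\<close>, for a regular
\<open>r \<in> M\<close>, is then a regular finitely generated radical ideal inside \<open>M\<close>. It remains to go from such an
ideal \<open>J \<subseteq> M\<close>, for each \<open>M\<close>, back to the sets \<open>V\<^sub>n(r)\<close>. Finitely many denominators are cleared by a
single element outside \<open>M\<close>, so near \<open>M\<close> the ideal \<open>J\<close> is generated by one element \<open>y\<close>, which has
value at most 1 there because \<open>J\<close> is radical. A regular \<open>r\<close> with \<open>n = v\<^sub>M(r)\<close> divides \<open>y\<^sup>n\<close> near \<open>M\<close>,
hence has value at most \<open>n\<close> there (\<open>local_bound\<close>). Thus \<open>N \<mapsto> v\<^sub>N(r)\<close> is upper semicontinuous, which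
is the closedness of the \<open>V\<^sub>n(r)\<close>, and quasi-compactness of the spectrum bounds it
(\<open>local_bounds_imp_closed\<close>, \<open>local_bounds_imp_bounded\<close>).
\<close>

section \<open>Ideals of commutative rings\<close>

lemma (in cring) cring_idealI:
  assumes "I \<subseteq> carrier R" "\<zero> \<in> I"
    and "\<And>x y. x \<in> I \<Longrightarrow> y \<in> I \<Longrightarrow> x \<oplus> y \<in> I"
    and "\<And>r x. r \<in> carrier R \<Longrightarrow> x \<in> I \<Longrightarrow> r \<otimes> x \<in> I"
  shows "ideal I R"
proof (rule idealI)
  show "ring R" by (rule ring_axioms)
  have "\<ominus> x \<in> I" if "x \<in> I" for x
    using assms(4)[of "\<ominus> \<one>" x] that assms(1) by (auto simp: l_minus)
  then show "subgroup I (add_monoid R)"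
    using assms by (intro add.subgroupI) (auto simp flip: a_inv_def)
  show "r \<otimes> x \<in> I" if "x \<in> I" "r \<in> carrier R" for r x
    using that assms by blast
  then show "x \<otimes> r \<in> I" if "x \<in> I" "r \<in> carrier R" for r x
    using that assms by (metis m_comm subsetD)
qed

lemma (in cring) ideal_subset: "ideal I R \<Longrightarrow> I \<subseteq> carrier R"
  by (auto dest: ideal.Icarr)

text \<open>By Zorn's lemma on the ideals above \<open>I\<close> that do not contain 1.\<close>

lemma (in cring) ex_maximalideal:
  assumes I: "ideal I R" "I \<noteq> carrier R"
  obtains M where "maximalideal M R" "I \<subseteq> M"
proof -
  let ?A = "{J. ideal J R \<and> I \<subseteq> J \<and> \<one> \<notin> J}"
  have "\<exists>M\<in>?A. \<forall>J\<in>?A. M \<subseteq> J \<longrightarrow> J = M"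
  proof (rule subset_Zorn_nonempty)
    show "?A \<noteq> {}" using I ideal.one_imp_carrier by blast
    fix C assume C: "C \<noteq> {}" "subset.chain ?A C"
    have C_ideal: "ideal J R" "I \<subseteq> J" "\<one> \<notin> J" if "J \<in> C" for J
      using C(2) that by (auto simp: subset.chain_def)
    have "ideal (\<Union>C) R"
    proof (rule cring_idealI)
      show "\<Union>C \<subseteq> carrier R" by (auto dest: ideal.Icarr[OF C_ideal(1)])
      show "\<zero> \<in> \<Union>C"
        using C(1) additive_subgroup.zero_closed[OF ideal.axioms(1)[OF C_ideal(1)]] by blast
    next
      fix x y assume "x \<in> \<Union>C" "y \<in> \<Union>C"
      then obtain J K where "J \<in> C" "K \<in> C" "x \<in> J" "y \<in> K" by blast
      moreover have "J \<subseteq> K \<or> K \<subseteq> J"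
        using C(2) calculation by (auto simp: subset.chain_def subset_chain_def)
      ultimately obtain J where J: "J \<in> C" "x \<in> J" "y \<in> J" by blast
      have "x \<oplus> y \<in> J"
        by (rule additive_subgroup.a_closed[OF ideal.axioms(1)[OF C_ideal(1)[OF J(1)]] J(2,3)])
      then show "x \<oplus> y \<in> \<Union>C" using J(1) by blast
    next
      fix r x assume "r \<in> carrier R" "x \<in> \<Union>C"
      then show "r \<otimes> x \<in> \<Union>C" using ideal.I_l_closed[OF C_ideal(1)] by blast
    qed
    then show "\<Union>C \<in> ?A" using C_ideal(2,3) C(1) by blast
  qed
  then obtain M where "M \<in> ?A" and max: "\<forall>J\<in>?A. M \<subseteq> J \<longrightarrow> J = M" by (rule bexE)
  then have M: "ideal M R" "I \<subseteq> M" "\<one> \<notin> M" by simp_all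
  have "maximalideal M R"
  proof (rule maximalidealI)
    show "carrier R \<noteq> M" using M by blast
    fix J assume "ideal J R" "M \<subseteq> J" "J \<subseteq> carrier R"
    then show "J = M \<or> J = carrier R"
      using bspec[OF max, of J] ideal.one_imp_carrier[of J R] M(2) by auto
  qed (rule M)
  then show thesis using that M(2) by blast
qed

lemma (in cring) prime_pow:
  assumes "primeideal P R" "x \<in> carrier R" "x [^] (n :: nat) \<in> P"
  shows "x \<in> P"
  using assms(3)
proof (induction n)
  case 0
  then show ?case
    using ideal.one_imp_carrier[OF primeideal.axioms(1)[OF assms(1)]]
      primeideal.I_notcarr[OF assms(1)] by simp
next
  case (Suc n)
  then show ?case using primeideal.I_prime[OF assms(1), of "x [^] n" x] assms(2) by auto
qed

lemma regular_ideal_ideal: "regular_ideal I R \<Longrightarrow> ideal I R"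
  by (simp add: regular_ideal_def)

lemma regular_idealD: "regular_ideal I R \<Longrightarrow> I \<inter> Reg R \<noteq> {}"
  by (simp add: regular_ideal_def)

lemma (in cring) regular_ideal_subset: "regular_ideal I R \<Longrightarrow> I \<subseteq> carrier R"
  by (auto simp: regular_ideal_def intro: ideal.Icarr)

lemma (in cring) regular_ideal_mono: "regular_ideal I R \<Longrightarrow> ideal J R \<Longrightarrow> I \<subseteq> J \<Longrightarrow> regular_ideal J R"
  unfolding regular_ideal_def by blast

lemma (in cring) regular_ideal_carrier: "regular_ideal (carrier R) R"
  using oneideal one_Reg by (auto simp: regular_ideal_def)

lemma (in cring) regular_ideal_prod:
  assumes I: "regular_ideal I R" and J: "regular_ideal J R"
  shows "regular_ideal (I \<cdot> J) R"
proof -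
  obtain x y where "x \<in> I \<inter> Reg R" "y \<in> J \<inter> Reg R"
    using assms unfolding regular_ideal_def by blast
  then have "x \<otimes> y \<in> (I \<cdot> J) \<inter> Reg R" by (simp add: ideal_prod.prod Reg_mult)
  then show ?thesis
    using ideal_prod_is_ideal[OF regular_ideal_ideal[OF I] regular_ideal_ideal[OF J]]
    unfolding regular_ideal_def by blast
qed

lemma (in cring) cgenideal_subset_iff:
  assumes "x \<in> carrier R" "ideal I R"
  shows "PIdl x \<subseteq> I \<longleftrightarrow> x \<in> I"
  using cgenideal_minimal[OF assms(2)] cgenideal_self[OF assms(1)] by auto

lemma (in cring) regular_ideal_cgenideal: "x \<in> Reg R \<Longrightarrow> regular_ideal (PIdl x) R"
  using cgenideal_ideal cgenideal_self Reg_closed by (auto simp: regular_ideal_def)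

lemma ideals_set_one: "\<one>\<^bsub>ideals_set R\<^esub> = carrier R"
  and ideals_set_mult: "I \<otimes>\<^bsub>ideals_set R\<^esub> J = ideal_prod R I J"
  by (simp_all add: ideals_set_def)

lemma (in cring) ideal_ideal_pow: "ideal P R \<Longrightarrow> ideal (P [^]\<^bsub>ideals_set R\<^esub> (n :: nat)) R"
  by (induction n) (simp_all add: ideals_set_one ideals_set_mult oneideal ideal_prod_is_ideal)

lemma (in cring) ideal_pow_subset:
  assumes "ideal P R" "1 \<le> n"
  shows "P [^]\<^bsub>ideals_set R\<^esub> (n :: nat) \<subseteq> P"
proof -
  obtain m where "n = Suc m" using assms(2) by (cases n) auto
  then show ?thesis
    using ideal_prod_inter[OF ideal_ideal_pow[OF assms(1), of m] assms(1)]
    by (simp add: ideals_set_mult)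
qed

lemma (in cring) regular_ideal_pow:
  "regular_ideal I R \<Longrightarrow> regular_ideal (I [^]\<^bsub>ideals_set R\<^esub> (n :: nat)) R"
  by (induction n) (simp_all add: ideals_set_one ideals_set_mult regular_ideal_carrier regular_ideal_prod)

lemma ideal_list_prod_Nil: "ideal_list_prod R [] = carrier R"
  and ideal_list_prod_Cons: "ideal_list_prod R (J # Js) = ideal_prod R J (ideal_list_prod R Js)"
  by (simp_all add: ideal_list_prod_def)

lemma (in cring) ideal_list_prod_ideal:
  "\<forall>J \<in> set Js. ideal J R \<Longrightarrow> ideal (ideal_list_prod R Js) R"
  by (induction Js)
    (simp_all add: ideal_list_prod_Nil ideal_list_prod_Cons oneideal ideal_prod_is_ideal)

lemma (in cring) ideal_list_prod_subset:
  "\<forall>J \<in> set Js. ideal J R \<Longrightarrow> J \<in> set Js \<Longrightarrow> ideal_list_prod R Js \<subseteq> J"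
proof (induction Js)
  case (Cons K Js)
  have "ideal_list_prod R (K # Js) \<subseteq> K \<inter> ideal_list_prod R Js"
    unfolding ideal_list_prod_Cons
    using Cons.prems ideal_list_prod_ideal by (intro ideal_prod_inter) simp_all
  then show ?case using Cons by auto
qed simp

lemma (in cring) pow_mem_list_prod:
  "x \<in> carrier R \<Longrightarrow> \<forall>J \<in> set Js. x \<in> J \<Longrightarrow> x [^] length Js \<in> ideal_list_prod R Js"
proof (induction Js)
  case (Cons J Js)
  have "x \<otimes> x [^] length Js \<in> J \<cdot> ideal_list_prod R Js"
    using Cons by (intro ideal_prod.prod) simp_all
  then show ?case using Cons.prems(1) nat_pow_Suc2[of x "length Js"] by (simp add: ideal_list_prod_Cons)
qed (simp add: ideal_list_prod_Nil)

lemma (in cring) radical_idealD: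
  fixes n :: nat
  assumes "radical_ideal J R" "x \<in> carrier R" "x [^] n \<in> J" "1 \<le> n"
  shows "x \<in> J"
proof -
  have "x \<in> ideal_radical R J" using assms(2-4) by (auto simp: ideal_radical_def)
  then show ?thesis using assms(1) by (simp add: radical_ideal_def)
qed

lemma (in cring) subset_ideal_radical: "I \<subseteq> carrier R \<Longrightarrow> I \<subseteq> ideal_radical R I"
proof
  fix x assume "I \<subseteq> carrier R" "x \<in> I"
  then have "x \<in> carrier R" "x [^] (1 :: nat) \<in> I" by auto
  then show "x \<in> ideal_radical R I" unfolding ideal_radical_def by blast
qed

lemma (in cring) ideal_radical_idem:
  assumes "I \<subseteq> carrier R"
  shows "ideal_radical R (ideal_radical R I) = ideal_radical R I"
proof
  show "ideal_radical R (ideal_radical R I) \<subseteq> ideal_radical R I"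
  proof
    fix x assume "x \<in> ideal_radical R (ideal_radical R I)"
    then obtain m n :: nat where x: "x \<in> carrier R" "1 \<le> m" "1 \<le> n" "(x [^] m) [^] n \<in> I"
      by (auto simp: ideal_radical_def)
    then have "x [^] (m * n) \<in> I" "1 \<le> m * n" by (simp_all add: nat_pow_pow)
    then show "x \<in> ideal_radical R I" using x(1) unfolding ideal_radical_def by blast
  qed
  show "ideal_radical R I \<subseteq> ideal_radical R (ideal_radical R I)"
    by (rule subset_ideal_radical) (auto simp: ideal_radical_def)
qed

text \<open>The first factor contains the product, and the power of any of its elements with exponent the
number of factors lies in the product, because the other factors are larger.\<close>

lemma (in cring) radical_of_chain_prod:
  assumes rad: "\<forall>K \<in> set (J # Js). radical_ideal K R" and chain: "sorted_wrt (\<subseteq>) (J # Js)"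
  shows "ideal_radical R (ideal_list_prod R (J # Js)) = J"
proof
  have ideals: "\<forall>K \<in> set (J # Js). ideal K R" and J: "ideal_radical R J = J"
    using rad by (simp_all add: radical_ideal_def)
  have "ideal_list_prod R (J # Js) \<subseteq> J" by (rule ideal_list_prod_subset[OF ideals]) simp
  then have "ideal_radical R (ideal_list_prod R (J # Js)) \<subseteq> ideal_radical R J"
    unfolding ideal_radical_def by blast
  then show "ideal_radical R (ideal_list_prod R (J # Js)) \<subseteq> J" using J by simp
  show "J \<subseteq> ideal_radical R (ideal_list_prod R (J # Js))"
  proof
    fix x assume x: "x \<in> J"
    then have xR: "x \<in> carrier R" using ideals by (auto dest: ideal.Icarr)
    have "x [^] length (J # Js) \<in> ideal_list_prod R (J # Js)"
      using chain x by (intro pow_mem_list_prod xR) auto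
    moreover have "1 \<le> length (J # Js)" by simp
    ultimately show "x \<in> ideal_radical R (ideal_list_prod R (J # Js))"
      using xR unfolding ideal_radical_def by blast
  qed
qed

lemma (in cring) regular_factors:
  assumes "\<forall>J \<in> set Js. radical_ideal J R" "regular_ideal (ideal_list_prod R Js) R"
  shows "\<forall>J \<in> set Js. radical_ideal J R \<and> regular_ideal J R"
proof -
  have Js: "\<forall>J \<in> set Js. ideal J R" using assms(1) by (simp add: radical_ideal_def)
  then show ?thesis
    using assms regular_ideal_mono[OF assms(2)] ideal_list_prod_subset[OF Js] by blast
qed

lemma (in cring) fin_gen_ideal_ideal: "fin_gen_ideal I R \<Longrightarrow> ideal I R"
  unfolding fin_gen_ideal_def using genideal_ideal by auto

lemma (in cring) fin_gen_cgenideal: "x \<in> carrier R \<Longrightarrow> fin_gen_ideal (PIdl x) R"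
  unfolding fin_gen_ideal_def by (intro exI[of _ "{x}"]) (simp add: cgenideal_eq_genideal)

text \<open>Only finitely many elements of \<open>J\<close> occur in an expression of \<open>r\<close> as an element of \<open>J \<cdot> B\<close>. Multiplying
this expression by \<open>j \<in> J\<close> and dividing by \<open>r\<close>, which divides \<open>j b\<close> for \<open>b \<in> B\<close>, expresses \<open>j\<close>
through them.\<close>

lemma (in cring) invertible_imp_fin_gen:
  assumes J: "ideal J R" and B: "ideal B R" and r: "r \<in> Reg R" and eq: "J \<cdot> B = PIdl r"
  shows "fin_gen_ideal J R"
proof -
  note JR = ideal.Icarr[OF J] and BR = ideal.Icarr[OF B] and rR = Reg_closed[OF r]
  have "\<exists>F. finite F \<and> F \<subseteq> J \<and> s \<in> (Idl F) \<cdot> B" if "s \<in> J \<cdot> B" for s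
    using that
  proof (induction rule: ideal_prod.induct)
    case (prod i j)
    then have "i \<in> Idl {i}" using genideal_self'[of i] JR by simp
    then have "i \<otimes> j \<in> (Idl {i}) \<cdot> B" using prod by (simp add: ideal_prod.prod)
    then show ?case using prod by (intro exI[of _ "{i}"]) simp
  next
    case (sum s1 s2)
    then obtain F1 F2 where F: "finite F1" "F1 \<subseteq> J" "s1 \<in> (Idl F1) \<cdot> B"
      "finite F2" "F2 \<subseteq> J" "s2 \<in> (Idl F2) \<cdot> B" by auto
    have mono: "s \<in> (Idl (F1 \<union> F2)) \<cdot> B" if "s \<in> (Idl F) \<cdot> B" "F \<subseteq> F1 \<union> F2" for s F
    proof -
      have "Idl F \<subseteq> Idl (F1 \<union> F2)"
        using that(2) F ideal_subset[OF J] by (intro subset_Idl_subset) auto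
      show ?thesis
        using that(1) \<open>Idl F \<subseteq> Idl (F1 \<union> F2)\<close>
        by (induction rule: ideal_prod.induct) (auto intro: ideal_prod.intros)
    qed
    have "s1 \<oplus> s2 \<in> (Idl (F1 \<union> F2)) \<cdot> B"
      using mono[OF F(3)] mono[OF F(6)] by (intro ideal_prod.sum) auto
    then show ?case using F by (intro exI[of _ "F1 \<union> F2"]) simp
  qed
  then obtain F where F: "finite F" "F \<subseteq> J" "r \<in> (Idl F) \<cdot> B"
    using cgenideal_self[OF rR] eq by blast
  have FR: "F \<subseteq> carrier R" using F(2) ideal_subset[OF J] by simp
  note IF = genideal_ideal[OF FR]
  note FcR = ideal.Icarr[OF IF]
  have "j \<in> Idl F" if j: "j \<in> J" for j
  proof -
    note jR = JR[OF j]
    have "\<exists>c \<in> Idl F. j \<otimes> s = r \<otimes> c \<and> s \<in> carrier R" if "s \<in> (Idl F) \<cdot> B" for s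
      using that
    proof (induction rule: ideal_prod.induct)
      case (prod f b)
      have "j \<otimes> b \<in> PIdl r" unfolding eq[symmetric] using j prod by (simp add: ideal_prod.prod)
      then obtain d where d: "d \<in> carrier R" "j \<otimes> b = d \<otimes> r" by (auto simp: cgenideal_def)
      have "j \<otimes> (f \<otimes> b) = (j \<otimes> b) \<otimes> f" using jR FcR[OF prod(1)] BR[OF prod(2)] by algebra
      also have "\<dots> = r \<otimes> (d \<otimes> f)" using d FcR[OF prod(1)] rR by (simp add: m_ac)
      finally show ?case
        using ideal.I_l_closed[OF IF prod(1) d(1)] FcR[OF prod(1)] BR[OF prod(2)] by auto
    next
      case (sum s1 s2)
      then obtain c1 c2 where c: "c1 \<in> Idl F" "j \<otimes> s1 = r \<otimes> c1" "c2 \<in> Idl F" "j \<otimes> s2 = r \<otimes> c2"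
        and s: "s1 \<in> carrier R" "s2 \<in> carrier R" by auto
      have "j \<otimes> (s1 \<oplus> s2) = r \<otimes> (c1 \<oplus> c2)"
        using c s jR rR FcR by (simp add: r_distr)
      moreover have "c1 \<oplus> c2 \<in> Idl F"
        using c additive_subgroup.a_closed[OF ideal.axioms(1)[OF IF]] by simp
      ultimately show ?case using s by auto
    qed
    from this[OF F(3)] obtain c where c: "c \<in> Idl F" "j \<otimes> r = r \<otimes> c" by auto
    then have "r \<otimes> j = r \<otimes> c" using m_comm[OF jR rR] by simp
    then have "j = c" by (rule Reg_cancel[OF r jR FcR[OF c(1)]])
    then show ?thesis using c by simp
  qed
  moreover have "Idl F \<subseteq> J" by (rule genideal_minimal[OF J F(2)])
  ultimately have "J = Idl F" by blast
  then show ?thesis using F(1) FR unfolding fin_gen_ideal_def by blast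
qed

section \<open>Closed sets of primes\<close>

lemma closedin_Spec_subset: "E \<subseteq> carrier R \<Longrightarrow> closedin (Zariski R) {P \<in> Spec R. E \<subseteq> P}"
  by (auto simp: closedin_Zariski)

text \<open>A point lies in at least \<open>n\<close> of the sets \<open>V(J), V(J\<^sub>1), \<dots>\<close> if it lies in \<open>n\<close> of the tail, or in \<open>V(J)\<close>
and in \<open>n - 1\<close> of the tail. For \<open>n = 0\<close> truncated subtraction is harmless, since the first alternative
is always true.\<close>

lemma closedin_count:
  assumes "\<forall>J \<in> set Js. J \<subseteq> carrier R"
  shows "closedin (Zariski R) {P \<in> Spec R. n \<le> length (filter (\<lambda>J. J \<subseteq> P) Js)}"
  using assms
proof (induction Js arbitrary: n)
  case Nil
  show ?case using closedin_topspace[of "Zariski R"] by (cases n) (simp_all add: topspace_Zariski)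
next
  case (Cons J Js)
  let ?C = "\<lambda>n. {P \<in> Spec R. n \<le> length (filter (\<lambda>J. J \<subseteq> P) Js)}"
  have "{P \<in> Spec R. n \<le> length (filter (\<lambda>J. J \<subseteq> P) (J # Js))}
      = ?C n \<union> ({P \<in> Spec R. J \<subseteq> P} \<inter> ?C (n - 1))"
    by auto
  then show ?case
    using Cons closedin_Spec_subset[of J R]
    by (simp del: filter.simps add: closedin_Un closedin_Int)
qed

text \<open>The entries of an ascending chain that lie in \<open>P\<close> form an initial segment.\<close>

lemma count_chain:
  assumes "sorted_wrt (\<subseteq>) Js" "n < length Js"
  shows "n < length (filter (\<lambda>J. J \<subseteq> P) Js) \<longleftrightarrow> Js ! n \<subseteq> P"
  using assms
proof (induction Js arbitrary: n)
  case (Cons J Js)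
  show ?case
  proof (cases "J \<subseteq> P")
    case True
    then show ?thesis using Cons by (cases n) simp_all
  next
    case False
    then have out: "\<not> K \<subseteq> P" if "K \<in> set (J # Js)" for K
      using Cons.prems(1) that by auto
    then have "filter (\<lambda>J. J \<subseteq> P) (J # Js) = []" by (simp add: filter_empty_conv)
    moreover have "\<not> (J # Js) ! n \<subseteq> P" using out nth_mem[OF Cons.prems(2)] by blast
    ultimately show ?thesis by simp
  qed
qed simp

text \<open>Converts a closed set of primes above a regular ideal into the radical ideal defining it. The
intersection with the carrier matters only for the empty set, which gives the unit ideal.\<close>

lemma (in cring) ideal_of_closed:
  assumes I: "regular_ideal I R" and C: "closedin (Zariski R) C"
    and sub: "\<And>P. P \<in> C \<Longrightarrow> I \<subseteq> P"
  defines "J \<equiv> carrier R \<inter> \<Inter>C"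
  shows "radical_ideal J R" "regular_ideal J R" "\<And>P. P \<in> Spec R \<Longrightarrow> J \<subseteq> P \<longleftrightarrow> P \<in> C"
proof -
  obtain E where E: "E \<subseteq> carrier R" "C = {P \<in> Spec R. E \<subseteq> P}"
    using C by (auto simp: closedin_Zariski)
  have prime: "primeideal P R" if "P \<in> C" for P using that E(2) by (simp add: Spec_def)
  note ideal_P = primeideal.axioms(1)[OF prime]
  have J: "ideal J R"
  proof (rule cring_idealI)
    show "\<zero> \<in> J"
      using additive_subgroup.zero_closed[OF ideal.axioms(1)[OF ideal_P]] by (auto simp: J_def)
    show "x \<oplus> y \<in> J" if "x \<in> J" "y \<in> J" for x y
      using that additive_subgroup.a_closed[OF ideal.axioms(1)[OF ideal_P]] by (auto simp: J_def)
    show "r \<otimes> x \<in> J" if "r \<in> carrier R" "x \<in> J" for r x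
      using that ideal.I_l_closed[OF ideal_P] by (auto simp: J_def)
  qed (simp add: J_def)
  have "x \<in> J" if "x \<in> ideal_radical R J" for x
    using that prime_pow[OF prime] by (auto simp: ideal_radical_def J_def)
  moreover have "J \<subseteq> ideal_radical R J"
    by (rule subset_ideal_radical[OF ideal_subset[OF J]])
  ultimately have "ideal_radical R J = J" by blast
  then show "radical_ideal J R" using J by (simp add: radical_ideal_def)
  have "I \<subseteq> J" using sub regular_ideal_subset[OF I] by (auto simp: J_def)
  then show "regular_ideal J R" by (rule regular_ideal_mono[OF I J])
  show "J \<subseteq> P \<longleftrightarrow> P \<in> C" if "P \<in> Spec R" for P
  proof
    have "E \<subseteq> J" using E by (auto simp: J_def)
    then show "P \<in> C" if "J \<subseteq> P" using that \<open>P \<in> Spec R\<close> E(2) by blast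
  qed (auto simp: J_def)
qed

lemma (in cring) V_pow_cgenideal:
  assumes "x \<in> carrier R"
  shows "V_pow R n (PIdl x) = V_pow R n {x}"
proof -
  have "PIdl x \<subseteq> P [^]\<^bsub>ideals_set R\<^esub> n \<longleftrightarrow> {x} \<subseteq> P [^]\<^bsub>ideals_set R\<^esub> n" if "P \<in> Spec R" for P
    using that cgenideal_subset_iff[OF assms ideal_ideal_pow[OF primeideal.axioms(1)]]
    by (simp add: Spec_def)
  then show ?thesis by (auto simp: V_pow_def)
qed

lemma (in cring) V_pow_subset:
  assumes "regular_ideal I R" "1 \<le> n" "P \<in> V_pow R n I"
  shows "I \<subseteq> P"
proof -
  have "P \<in> Spec R" "I \<subseteq> P [^]\<^bsub>ideals_set R\<^esub> n" using assms(3) by (simp_all add: V_pow_def)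
  moreover from this have "ideal P R" by (simp add: Spec_def primeideal.axioms(1))
  ultimately show ?thesis using ideal_pow_subset assms(2) by blast
qed

text \<open>A regular ideal lies in a power of \<open>P\<close> as soon as its regular elements do, since they generate it.\<close>

lemma (in marot_ring) V_pow_eq_INT:
  assumes I: "regular_ideal I R"
  shows "V_pow R n I = (\<Inter>x \<in> I \<inter> Reg R. V_pow R n {x})"
proof
  show "V_pow R n I \<subseteq> (\<Inter>x \<in> I \<inter> Reg R. V_pow R n {x})" by (auto simp: V_pow_def)
  obtain S where S: "S \<subseteq> Reg R" "I = Idl S" using regular_generators[OF I] by blast
  then have SR: "S \<subseteq> carrier R" by (auto dest: Reg_closed)
  have SI: "S \<subseteq> I" using genideal_self[OF SR] S(2) by simp
  show "(\<Inter>x \<in> I \<inter> Reg R. V_pow R n {x}) \<subseteq> V_pow R n I"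
  proof
    fix P assume P: "P \<in> (\<Inter>x \<in> I \<inter> Reg R. V_pow R n {x})"
    then have spec: "P \<in> Spec R" using regular_idealD[OF I] by (auto simp: V_pow_def)
    then have "ideal P R" by (simp add: Spec_def primeideal.axioms(1))
    moreover have "S \<subseteq> P [^]\<^bsub>ideals_set R\<^esub> n" using P S(1) SI by (auto simp: V_pow_def)
    ultimately have "I \<subseteq> P [^]\<^bsub>ideals_set R\<^esub> n"
      unfolding S(2) by (intro genideal_minimal ideal_ideal_pow)
    then show "P \<in> V_pow R n I" using spec by (simp add: V_pow_def)
  qed
qed

section \<open>Valuations of regular localizations\<close>

text \<open>The values of ring elements are nonnegative, so on the ring the valuation can be recorded in
\<^typ>\<open>enat\<close>. The quotient ring is eliminated here: divisibility by a regular element and the surjectivity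
of the valuation become statements about the ring alone.\<close>

lemma (in discrete_rank_one_Manis_valuation_ring) ex_enat_valuation:
  obtains w :: "'a \<Rightarrow> enat"
  where "w \<one> = 0" "w \<zero> = infinity"
    "\<And>x y. x \<in> carrier R \<Longrightarrow> y \<in> carrier R \<Longrightarrow> w (x \<otimes> y) = w x + w y"
    "\<And>x y. x \<in> carrier R \<Longrightarrow> y \<in> carrier R \<Longrightarrow> min (w x) (w y) \<le> w (x \<oplus> y)"
    "\<And>s. s \<in> Reg R \<Longrightarrow> w s \<noteq> infinity"
    "\<And>x s. x \<in> carrier R \<Longrightarrow> s \<in> Reg R \<Longrightarrow> w s \<le> w x \<Longrightarrow> \<exists>y \<in> carrier R. x = y \<otimes> s"
    "\<exists>x \<in> carrier R. \<exists>s \<in> Reg R. w x = w s + 1"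
proof -
  let ?K = "total_quotient_ring R"
  let ?f = "\<lambda>a. fraction R a \<one>"
  obtain v :: "('a \<times> 'a) set \<Rightarrow> int extended" where
    v: "v ` carrier ?K = range Fin \<union> {Pinf} \<and> v \<one>\<^bsub>?K\<^esub> = Fin 0 \<and> v \<zero>\<^bsub>?K\<^esub> = Pinf \<and>
      (\<forall>x \<in> carrier ?K. \<forall>y \<in> carrier ?K. v (x \<otimes>\<^bsub>?K\<^esub> y) = v x + v y) \<and>
      (\<forall>x \<in> carrier ?K. \<forall>y \<in> carrier ?K. v (x \<oplus>\<^bsub>?K\<^esub> y) \<ge> min (v x) (v y)) \<and>
      ?f ` carrier R = {x \<in> carrier ?K. v x \<ge> Fin 0}"
    using ex_valuation unfolding Let_def by (rule exE)
  then have range: "v ` carrier ?K = range Fin \<union> {Pinf}"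
    and v1: "v \<one>\<^bsub>?K\<^esub> = Fin 0" and v0: "v \<zero>\<^bsub>?K\<^esub> = Pinf"
    and integral: "?f ` carrier R = {x \<in> carrier ?K. Fin 0 \<le> v x}"
    by simp_all
  have mult: "v (x \<otimes>\<^bsub>?K\<^esub> y) = v x + v y" if "x \<in> carrier ?K" "y \<in> carrier ?K" for x y
    using v that by simp
  have add: "min (v x) (v y) \<le> v (x \<oplus>\<^bsub>?K\<^esub> y)" if "x \<in> carrier ?K" "y \<in> carrier ?K" for x y
    using v that by simp
  \<comment> \<open>The value \<^const>\<open>Minf\<close> does not occur; sending it to infinity is a default.\<close>
  define ext :: "int extended \<Rightarrow> enat" where
    "ext e = (case e of Fin k \<Rightarrow> enat (nat k) | _ \<Rightarrow> infinity)" for e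
  have ext_add: "ext (d + e) = ext d + ext e" if "Fin 0 \<le> d" "Fin 0 \<le> e" for d e
    using that by (cases d; cases e) (auto simp: ext_def nat_add_distrib)
  have ext_mono: "ext d \<le> ext e \<longleftrightarrow> d \<le> e" if "Fin 0 \<le> d" "Fin 0 \<le> e" for d e
    using that by (cases d; cases e) (auto simp: ext_def)
  have fin: "(\<exists>k. v x = Fin k) \<or> v x = Pinf" if "x \<in> carrier ?K" for x
    using range that by blast
  have one: "\<one>\<^bsub>?K\<^esub> = ?f \<one>" and zero: "\<zero>\<^bsub>?K\<^esub> = ?f \<zero>"
    by (simp_all add: total_quotient_ring_def)
  have fK: "?f a \<in> carrier ?K" if "a \<in> carrier R" for a
    using that one_Reg by (rule fraction_closed)
  have pos: "Fin 0 \<le> v (?f a)" if "a \<in> carrier R" for a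
    using integral that by blast
  define w where "w a = ext (v (?f a))" for a
  have cancel: "fraction R a s \<otimes>\<^bsub>?K\<^esub> ?f s = ?f a" if "a \<in> carrier R" "s \<in> Reg R" for a s
    using that by (simp add: fraction_mult fraction_eq_iff one_Reg Reg_closed m_comm)
  have v_div: "v (fraction R a s) + v (?f s) = v (?f a)" if "a \<in> carrier R" "s \<in> Reg R" for a s
    using mult[OF fraction_closed[OF that] fK[OF Reg_closed[OF that(2)]]] cancel[OF that] by simp
  \<comment> \<open>A regular element is invertible in the quotient ring, so its value is finite.\<close>
  have v_Reg: "\<exists>k. v (?f s) = Fin k" if "s \<in> Reg R" for s
  proof -
    have "v (fraction R \<one> s) + v (?f s) = Fin 0"
      using v_div[OF one_closed that] v1 one by simp
    then show ?thesis
      using fin[OF fraction_closed[OF one_closed that]] fin[OF fK[OF Reg_closed[OF that]]] by auto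
  qed
  show thesis
  proof (rule that[of w])
    show "w \<one> = 0" "w \<zero> = infinity"
      using v0 v1 one zero by (simp_all add: w_def ext_def zero_enat_def)
    fix x y assume x: "x \<in> carrier R" and y: "y \<in> carrier R"
    have "v (?f (x \<otimes> y)) = v (?f x) + v (?f y)"
      using mult[OF fK[OF x] fK[OF y]] x y by (simp add: fraction_mult one_Reg)
    then show "w (x \<otimes> y) = w x + w y"
      using ext_add[OF pos[OF x] pos[OF y]] by (simp add: w_def)
    have "min (v (?f x)) (v (?f y)) \<le> v (?f (x \<oplus> y))"
      using add[OF fK[OF x] fK[OF y]] x y by (simp add: fraction_add one_Reg)
    then show "min (w x) (w y) \<le> w (x \<oplus> y)"
      using ext_mono pos x y by (simp add: w_def min_le_iff_disj)
  next
    fix s assume "s \<in> Reg R"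
    then show "w s \<noteq> infinity" using v_Reg by (fastforce simp: w_def ext_def)
  next
    fix x s assume x: "x \<in> carrier R" and s: "s \<in> Reg R" and le: "w s \<le> w x"
    have "v (?f s) \<le> v (?f x)"
      using le ext_mono pos x s by (simp add: w_def Reg_closed)
    then have "Fin 0 \<le> v (fraction R x s)"
      using v_div[OF x s, symmetric] v_Reg[OF s] fin[OF fraction_closed[OF x s]] by auto
    then have "fraction R x s \<in> ?f ` carrier R"
      using integral fraction_closed[OF x s] by blast
    then obtain y where y: "y \<in> carrier R" "fraction R x s = ?f y" by blast
    then have "x \<otimes> \<one> = y \<otimes> s" using fraction_eq_iff x s one_Reg by metis
    then show "\<exists>y \<in> carrier R. x = y \<otimes> s" using x y by auto
  next
    have "Fin 1 \<in> v ` carrier ?K" using range by simp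
    then obtain p where p: "Fin 1 = v p" "p \<in> carrier ?K" by (rule imageE)
    obtain x s where xs: "x \<in> carrier R" "s \<in> Reg R" "v (fraction R x s) = Fin 1"
      using fraction_cases[OF p(2)] p(1) by metis
    obtain k where "v (?f s) = Fin k" using v_Reg xs by blast
    moreover have "0 \<le> k" using pos[of s] xs calculation by (simp add: Reg_closed)
    ultimately have "w x = w s + 1"
      using v_div[OF xs(1,2)] xs(3) by (cases "v (?f x)") (auto simp: w_def ext_def one_enat_def)
    then show "\<exists>x \<in> carrier R. \<exists>s \<in> Reg R. w x = w s + 1" using xs by blast
  qed
qed

text \<open>The trace that a discrete Manis valuation with centre \<open>M\<close> leaves on the ring. Divisibility holds only
after localizing at \<open>M\<close>, hence the factor \<open>t\<close> outside \<open>M\<close>.\<close>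

locale discrete_valuation_at = cring +
  fixes M :: "'a set" and v :: "'a \<Rightarrow> enat"
  assumes val_zero: "v \<zero> = infinity"
    and val_mult: "\<lbrakk>a \<in> carrier R; b \<in> carrier R\<rbrakk> \<Longrightarrow> v (a \<otimes> b) = v a + v b"
    and val_add: "\<lbrakk>a \<in> carrier R; b \<in> carrier R\<rbrakk> \<Longrightarrow> min (v a) (v b) \<le> v (a \<oplus> b)"
    and val_eq_0_iff: "a \<in> carrier R \<Longrightarrow> v a = 0 \<longleftrightarrow> a \<notin> M"
    and val_Reg: "s \<in> Reg R \<Longrightarrow> v s \<noteq> infinity"
    and uniformizer: "\<exists>y \<in> Reg R. v y = 1"
    and val_divides: "\<lbrakk>a \<in> carrier R; s \<in> Reg R; v s \<le> v a\<rbrakk>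
      \<Longrightarrow> \<exists>t \<in> carrier R - M. \<exists>b \<in> carrier R. a \<otimes> t = b \<otimes> s"

lemma enat_one_le_iff: "1 \<le> (x :: enat) \<longleftrightarrow> x \<noteq> 0"
  by (cases x) (auto simp: one_enat_def zero_enat_def)

lemma (in cring) ideal_val_ge:
  fixes v :: "'a \<Rightarrow> enat"
  assumes "v \<zero> = infinity"
    and "\<And>a b. \<lbrakk>a \<in> carrier R; b \<in> carrier R\<rbrakk> \<Longrightarrow> v (a \<otimes> b) = v a + v b"
    and "\<And>a b. \<lbrakk>a \<in> carrier R; b \<in> carrier R\<rbrakk> \<Longrightarrow> min (v a) (v b) \<le> v (a \<oplus> b)"
  shows "ideal {a \<in> carrier R. n \<le> v a} R"
proof (rule cring_idealI)
  fix a b assume "a \<in> {a \<in> carrier R. n \<le> v a}" "b \<in> {a \<in> carrier R. n \<le> v a}"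
  then show "a \<oplus> b \<in> {a \<in> carrier R. n \<le> v a}"
    using assms(3)[of a b] by (auto simp: min_def split: if_splits)
next
  fix a b assume "a \<in> carrier R" "b \<in> {a \<in> carrier R. n \<le> v a}"
  then show "a \<otimes> b \<in> {a \<in> carrier R. n \<le> v a}"
    using assms(2)[of a b] by (auto simp: add_increasing)
qed (auto simp: assms(1))

text \<open>The regular localization has its own total quotient ring, so the valuation is first restricted to
the localization and then to the ring. Two points use the Marot property. A regular element
of \<open>M\<close> is not invertible in the localization, so the generators of \<open>M\<close> have positive value, and by
maximality \<open>M\<close> is the whole set of elements of positive value. And since surjectivity yields an
element of \<open>M\<close> of value 1, the regular generators of \<open>M\<close> cannot all have value at least 2.\<close>

lemma (in marot_ring) ex_valuation_at:
  assumes M: "maximalideal M R" "regular_ideal M R"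
    and Manis: "discrete_rank_one_Manis_valuation_ring (reg_localization R M)"
  shows "\<exists>v. discrete_valuation_at R M v"
proof -
  let ?L = "reg_localization R M"
  let ?j = "\<lambda>a. fraction R a \<one>"
  interpret L: discrete_rank_one_Manis_valuation_ring ?L by (rule Manis)
  interpret M: maximalideal M R by (rule M)
  have U1: "\<one> \<in> Reg R \<inter> (carrier R - M)"
    using one_Reg M.one_imp_carrier M.I_notcarr by auto
  have L_ops: "x \<otimes>\<^bsub>?L\<^esub> y = x \<otimes>\<^bsub>total_quotient_ring R\<^esub> y"
    "x \<oplus>\<^bsub>?L\<^esub> y = x \<oplus>\<^bsub>total_quotient_ring R\<^esub> y"
    "\<one>\<^bsub>?L\<^esub> = ?j \<one>" "\<zero>\<^bsub>?L\<^esub> = ?j \<zero>" for x y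
    by (simp_all add: reg_localization_def total_quotient_ring_def)
  have L_closed: "fraction R a s \<in> carrier ?L"
    if "a \<in> carrier R" "s \<in> Reg R" "s \<notin> M" for a s
    using that by (auto simp: reg_localization_def dest: Reg_closed)
  have L_cases: "\<exists>a s. a \<in> carrier R \<and> s \<in> Reg R \<and> s \<notin> M \<and> x = fraction R a s"
    if "x \<in> carrier ?L" for x
    using that by (auto simp: reg_localization_def)
  have jL: "?j a \<in> carrier ?L" if "a \<in> carrier R" for a
    using L_closed that U1 by blast
  have j_Reg: "?j s \<in> Reg ?L" if "s \<in> Reg R" for s
  proof -
    have "x = \<zero>\<^bsub>?L\<^esub>" if x: "x \<in> carrier ?L" and 0: "?j s \<otimes>\<^bsub>?L\<^esub> x = \<zero>\<^bsub>?L\<^esub>" for x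
    proof -
      obtain a t where a: "a \<in> carrier R" "t \<in> Reg R" "x = fraction R a t"
        using L_cases[OF x] by blast
      have "(s \<otimes> a) \<otimes> \<one> = \<zero> \<otimes> (\<one> \<otimes> t)"
        using 0 a \<open>s \<in> Reg R\<close>
        by (simp add: L_ops fraction_mult fraction_eq_iff one_Reg Reg_mult Reg_closed)
      then have "s \<otimes> a = \<zero>" using a \<open>s \<in> Reg R\<close> by (simp add: Reg_closed)
      then have "a = \<zero>" using a \<open>s \<in> Reg R\<close> unfolding Reg_def by blast
      then show ?thesis using a by (simp add: L_ops fraction_eq_iff one_Reg Reg_closed)
    qed
    then show ?thesis using jL[OF Reg_closed[OF that]] unfolding Reg_def by blast
  qed
  obtain w :: "_ \<Rightarrow> enat" where w1: "w \<one>\<^bsub>?L\<^esub> = 0" and w0: "w \<zero>\<^bsub>?L\<^esub> = infinity"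
    and wmult: "\<And>x y. x \<in> carrier ?L \<Longrightarrow> y \<in> carrier ?L \<Longrightarrow> w (x \<otimes>\<^bsub>?L\<^esub> y) = w x + w y"
    and wadd: "\<And>x y. x \<in> carrier ?L \<Longrightarrow> y \<in> carrier ?L \<Longrightarrow> min (w x) (w y) \<le> w (x \<oplus>\<^bsub>?L\<^esub> y)"
    and wReg: "\<And>s. s \<in> Reg ?L \<Longrightarrow> w s \<noteq> infinity"
    and wdiv: "\<And>x s. x \<in> carrier ?L \<Longrightarrow> s \<in> Reg ?L \<Longrightarrow> w s \<le> w x
      \<Longrightarrow> \<exists>y \<in> carrier ?L. x = y \<otimes>\<^bsub>?L\<^esub> s"
    and wsurj: "\<exists>x \<in> carrier ?L. \<exists>s \<in> Reg ?L. w x = w s + 1"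
    by (rule L.ex_enat_valuation) blast
  define v where "v a = w (?j a)" for a
  have v0: "v \<zero> = infinity" and v1: "v \<one> = 0"
    using w0 w1 by (simp_all add: v_def L_ops)
  have vmult: "v (a \<otimes> b) = v a + v b" if "a \<in> carrier R" "b \<in> carrier R" for a b
    using wmult[OF jL jL, OF that] that by (simp add: v_def L_ops fraction_mult one_Reg)
  have vadd: "min (v a) (v b) \<le> v (a \<oplus> b)" if "a \<in> carrier R" "b \<in> carrier R" for a b
    using wadd[OF jL jL, OF that] that by (simp add: v_def L_ops fraction_add one_Reg)
  have vReg: "v s \<noteq> infinity" if "s \<in> Reg R" for s
    using wReg[OF j_Reg[OF that]] by (simp add: v_def)
  have vdiv: "\<exists>t \<in> Reg R - M. \<exists>b \<in> carrier R. a \<otimes> t = b \<otimes> s"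
    if a: "a \<in> carrier R" and s: "s \<in> Reg R" and le: "v s \<le> v a" for a s
  proof -
    obtain y where y: "y \<in> carrier ?L" "?j a = y \<otimes>\<^bsub>?L\<^esub> ?j s"
      using wdiv[OF jL[OF a] j_Reg[OF s]] le by (auto simp: v_def)
    obtain b t where b: "b \<in> carrier R" "t \<in> Reg R" "t \<notin> M" "y = fraction R b t"
      using L_cases[OF y(1)] by blast
    have "a \<otimes> (t \<otimes> \<one>) = (b \<otimes> s) \<otimes> \<one>"
      using y(2) a s b
      by (simp add: L_ops fraction_mult fraction_eq_iff one_Reg Reg_mult Reg_closed)
    then have "a \<otimes> t = b \<otimes> s" using a s b by (simp add: Reg_closed)
    then show ?thesis using b by blast
  qed
  have w_frac: "w (fraction R a t) + v t = v a"
    if "a \<in> carrier R" "t \<in> Reg R" "t \<notin> M" for a t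
  proof -
    have "fraction R a t \<otimes>\<^bsub>?L\<^esub> ?j t = ?j a"
      using that by (simp add: L_ops fraction_mult fraction_eq_iff one_Reg Reg_closed m_comm)
    then show ?thesis
      using wmult[OF L_closed[OF that] jL[OF Reg_closed[OF that(2)]]] by (simp add: v_def)
  qed
  have v_unit: "v t = 0" if "t \<in> Reg R" "t \<notin> M" for t
    using w_frac[OF one_closed that] v1 by simp
  have ideal_v: "ideal {a \<in> carrier R. n \<le> v a} R" for n
    using v0 vmult vadd by (rule ideal_val_ge)
  obtain S where S: "S \<subseteq> Reg R" "M = Idl S"
    using regular_generators[OF M(2)] by blast
  have SM: "S \<subseteq> M" using S genideal_self by (metis Reg_closed subset_iff)
  have "S \<subseteq> {a \<in> carrier R. 1 \<le> v a}"
  proof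
    fix s assume s: "s \<in> S"
    have "v s \<noteq> 0"
    proof
      assume "v s = 0"
      then obtain t b where t: "t \<in> Reg R" "t \<notin> M" "b \<in> carrier R" "\<one> \<otimes> t = b \<otimes> s"
        using vdiv[OF one_closed, of s] s S by auto
      then have "t = b \<otimes> s" by (simp add: Reg_closed)
      then show False using t s SM M.I_l_closed by blast
    qed
    then show "s \<in> {a \<in> carrier R. 1 \<le> v a}"
      using s S by (auto simp: Reg_closed ileI1 one_eSuc subset_iff)
  qed
  then have "M \<subseteq> {a \<in> carrier R. 1 \<le> v a}"
    unfolding S(2) by (rule genideal_minimal[OF ideal_v])
  moreover have "{a \<in> carrier R. 1 \<le> v a} \<noteq> carrier R" using v1 by force
  ultimately have M_eq: "M = {a \<in> carrier R. 1 \<le> v a}"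
    using M.I_maximal[OF ideal_v] by blast
  have "\<exists>y \<in> Reg R. v y = 1"
  proof -
    obtain x z where xz: "x \<in> carrier ?L" "z \<in> Reg ?L" "w x = w z + 1" using wsurj by blast
    obtain a s where a: "a \<in> carrier R" "s \<in> Reg R" "s \<notin> M" "x = fraction R a s"
      using L_cases[OF xz(1)] by blast
    obtain b t where b: "b \<in> carrier R" "t \<in> Reg R" "t \<notin> M" "z = fraction R b t"
      using L_cases[OF L.Reg_closed[OF xz(2)]] by blast
    have "c = \<zero>" if c: "c \<in> carrier R" "b \<otimes> c = \<zero>" for c
    proof -
      have "z \<otimes>\<^bsub>?L\<^esub> ?j c = \<zero>\<^bsub>?L\<^esub>"
        using b c by (simp add: L_ops fraction_mult fraction_eq_iff one_Reg Reg_closed)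
      then have "?j c = \<zero>\<^bsub>?L\<^esub>" using xz(2) jL[OF c(1)] unfolding Reg_def by blast
      then show "c = \<zero>" using c by (simp add: L_ops fraction_eq_iff one_Reg)
    qed
    then have b_Reg: "b \<in> Reg R" using b(1) by (simp add: Reg_def)
    have v_a: "v a = v b + 1"
      using w_frac[OF a(1-3)] w_frac[OF b(1-3)] v_unit a b xz(3) by simp
    then obtain u c where u: "u \<in> Reg R" "u \<notin> M" "c \<in> carrier R" "a \<otimes> u = c \<otimes> b"
      using vdiv[OF a(1) b_Reg] by auto
    have "v c + v b = v b + 1"
      using vmult[OF a(1) Reg_closed[OF u(1)]] vmult[OF u(3) b(1)] v_unit u v_a by simp
    then have v_c: "v c = 1"
      using vReg[OF b_Reg] by (cases "v b"; cases "v c") (auto simp: one_enat_def)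
    have "\<exists>y \<in> S. \<not> 2 \<le> v y"
    proof (rule ccontr)
      assume "\<not> ?thesis"
      then have "S \<subseteq> {a \<in> carrier R. 2 \<le> v a}" using S Reg_closed by blast
      then have "M \<subseteq> {a \<in> carrier R. 2 \<le> v a}"
        unfolding S(2) by (rule genideal_minimal[OF ideal_v])
      moreover have "c \<in> M" using v_c u(3) by (subst M_eq) simp
      ultimately have "(2 :: enat) \<le> 1" using v_c by force
      then show False by simp
    qed
    then obtain y where y: "y \<in> S" "\<not> 2 \<le> v y" by blast
    moreover have "1 \<le> v y" using y SM M_eq by blast
    ultimately have "v y = 1"
      by (cases "v y") (simp_all add: numeral_eq_enat one_enat_def)
    then show ?thesis using y S by blast
  qed
  moreover have "v a = 0 \<longleftrightarrow> a \<notin> M" if "a \<in> carrier R" for a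
    using that by (subst M_eq) (cases "v a"; auto simp: one_enat_def zero_enat_def)
  moreover have "\<exists>t \<in> carrier R - M. \<exists>b \<in> carrier R. a \<otimes> t = b \<otimes> s"
    if "a \<in> carrier R" "s \<in> Reg R" "v s \<le> v a" for a s
    using vdiv[OF that] Reg_closed by blast
  ultimately have "discrete_valuation_at R M v"
    using v0 vmult vadd vReg
    by (intro discrete_valuation_at.intro discrete_valuation_at_axioms.intro is_cring)
  then show ?thesis by blast
qed

section \<open>Order functions of regular ideals\<close>

locale marot_N_ring = marot_ring + N_ring

begin

definition regular_maximal :: "'a set \<Rightarrow> bool"
  where "regular_maximal M \<longleftrightarrow> maximalideal M R \<and> regular_ideal M R"

text \<open>The choice is immaterial: the value of an element is determined by the powers of \<open>M\<close> that contain
it.\<close>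

definition val :: "'a set \<Rightarrow> 'a \<Rightarrow> enat"
  where "val M = (SOME v. discrete_valuation_at R M v)"

text \<open>Totalized over all sets; the minimum exists whenever \<open>E\<close> contains a regular element, because
those have finite value.\<close>

definition ord :: "'a set \<Rightarrow> 'a set \<Rightarrow> nat"
  where "ord M E = (LEAST n. \<exists>x \<in> E. val M x = enat n)"

lemma valuation_val: "regular_maximal M \<Longrightarrow> discrete_valuation_at R M (val M)"
  unfolding val_def regular_maximal_def
  using ex_valuation_at localization_Manis by (metis (no_types) someI_ex)

lemmas val_zero = discrete_valuation_at.val_zero[OF valuation_val]
  and val_mult = discrete_valuation_at.val_mult[OF valuation_val]
  and val_add = discrete_valuation_at.val_add[OF valuation_val]
  and val_eq_0_iff = discrete_valuation_at.val_eq_0_iff[OF valuation_val]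
  and val_Reg = discrete_valuation_at.val_Reg[OF valuation_val]
  and uniformizer = discrete_valuation_at.uniformizer[OF valuation_val]
  and val_divides = discrete_valuation_at.val_divides[OF valuation_val]

lemma regular_maximal_ideal: "regular_maximal M \<Longrightarrow> ideal M R"
  by (simp add: regular_maximal_def regular_ideal_def)

lemma regular_maximal_regular: "regular_maximal M \<Longrightarrow> regular_ideal M R"
  by (simp add: regular_maximal_def)

lemma regular_maximal_prime: "regular_maximal M \<Longrightarrow> primeideal M R"
  by (simp add: regular_maximal_def maximalideal_prime)

lemma one_notin_regular_maximal: "regular_maximal M \<Longrightarrow> \<one> \<notin> M"
  using primeideal.I_notcarr[OF regular_maximal_prime]
    ideal.one_imp_carrier[OF regular_maximal_ideal] by blast

lemma regular_maximal_mult: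
  assumes "regular_maximal M" "s \<in> carrier R - M" "t \<in> carrier R - M"
  shows "s \<otimes> t \<in> carrier R - M"
  using assms primeideal.I_prime[OF regular_maximal_prime] by blast

lemma ex_regular_maximal:
  assumes "regular_ideal I R" "I \<noteq> carrier R"
  obtains M where "regular_maximal M" "I \<subseteq> M"
proof -
  obtain M where M: "maximalideal M R" "I \<subseteq> M"
    using ex_maximalideal[OF regular_ideal_ideal[OF assms(1)] assms(2)] .
  then have "regular_maximal M"
    using regular_ideal_mono[OF assms(1) maximalideal.axioms(1)] by (simp add: regular_maximal_def)
  then show thesis using that M(2) by blast
qed

lemma val_one: "regular_maximal M \<Longrightarrow> val M \<one> = 0"
  by (simp add: val_eq_0_iff one_notin_regular_maximal)

lemma val_pow:
  "regular_maximal M \<Longrightarrow> a \<in> carrier R \<Longrightarrow> val M (a [^] n) = of_nat n * val M a"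
  by (induction n) (simp_all add: val_one val_mult distrib_right add.commute)

lemma ideal_val_at_least: "regular_maximal M \<Longrightarrow> ideal {a \<in> carrier R. n \<le> val M a} R"
  by (rule ideal_val_ge) (simp_all add: val_zero val_mult val_add)

lemma ord_le_val:
  assumes "x \<in> E"
  shows "enat (ord M E) \<le> val M x"
proof (cases "val M x")
  case (enat n)
  then have "\<exists>x \<in> E. val M x = enat n" using assms by blast
  then have "ord M E \<le> n" unfolding ord_def by (rule Least_le)
  then show ?thesis using enat by simp
qed simp

lemma ord_attained:
  assumes "regular_maximal M" "E \<inter> Reg R \<noteq> {}"
  shows "\<exists>x \<in> E. val M x = enat (ord M E)"
proof -
  obtain x where "x \<in> E" "x \<in> Reg R" using assms(2) by blast
  then obtain n where "val M x = enat n" using val_Reg[OF assms(1)] by auto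
  with \<open>x \<in> E\<close> have "\<exists>n. \<exists>x \<in> E. val M x = enat n" by blast
  then show ?thesis unfolding ord_def by (rule LeastI_ex)
qed

lemma le_ord_iff:
  assumes "regular_maximal M" "E \<inter> Reg R \<noteq> {}"
  shows "n \<le> ord M E \<longleftrightarrow> (\<forall>x \<in> E. enat n \<le> val M x)"
proof
  assume "n \<le> ord M E"
  then show "\<forall>x \<in> E. enat n \<le> val M x"
    by (intro ballI order_trans[OF _ ord_le_val]) simp_all
next
  assume "\<forall>x \<in> E. enat n \<le> val M x"
  then show "n \<le> ord M E" using ord_attained[OF assms] by fastforce
qed

lemma ord_eq_0_iff:
  assumes "regular_maximal M" "E \<inter> Reg R \<noteq> {}" "E \<subseteq> carrier R"
  shows "ord M E = 0 \<longleftrightarrow> \<not> E \<subseteq> M"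
proof -
  have "1 \<le> ord M E \<longleftrightarrow> (\<forall>x \<in> E. 1 \<le> val M x)"
    using le_ord_iff[OF assms(1,2), of 1] by (simp add: one_enat_def)
  also have "\<dots> \<longleftrightarrow> E \<subseteq> M"
    using val_eq_0_iff[OF assms(1)] assms(3) by (auto simp: enat_one_le_iff)
  finally show ?thesis by linarith
qed

text \<open>The elements of value above the minimum form an ideal, so they cannot include a set of generators;
and there are regular generators.\<close>

lemma regular_ord_attained:
  assumes M: "regular_maximal M" and I: "regular_ideal I R"
  shows "\<exists>y \<in> I \<inter> Reg R. val M y = enat (ord M I)"
proof -
  obtain S where S: "S \<subseteq> Reg R" "I = Idl S" using regular_generators[OF I] by blast
  have SI: "S \<subseteq> I" using S genideal_self by (metis Reg_closed subset_iff)
  have "\<exists>y \<in> S. \<not> eSuc (enat (ord M I)) \<le> val M y"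
  proof (rule ccontr)
    assume "\<not> ?thesis"
    then have "S \<subseteq> {a \<in> carrier R. eSuc (enat (ord M I)) \<le> val M a}"
      using S(1) Reg_closed by blast
    then have "I \<subseteq> {a \<in> carrier R. eSuc (enat (ord M I)) \<le> val M a}"
      unfolding S(2) by (rule genideal_minimal[OF ideal_val_at_least[OF M]])
    moreover obtain x where "x \<in> I" "val M x = enat (ord M I)"
      using ord_attained[OF M] I unfolding regular_ideal_def by blast
    ultimately show False by (auto simp: eSuc_enat)
  qed
  then obtain y where y: "y \<in> S" "\<not> eSuc (enat (ord M I)) \<le> val M y" by blast
  then have "val M y = enat (ord M I)"
    using ord_le_val[of y I M] SI by (cases "val M y") (auto simp: eSuc_enat)
  then show ?thesis using y(1) S(1) SI by blast
qed

text \<open>The usual local-global argument with the conductor \<open>{t. a t \<in> I}\<close>. If it were proper it would lie in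
a regular maximal \<open>M\<close>; but \<open>I\<close> contains a regular element of minimal value at \<open>M\<close>, which divides \<open>a\<close>
up to a factor outside \<open>M\<close>.\<close>

lemma regular_memI:
  assumes I: "regular_ideal I R" and a: "a \<in> carrier R"
    and le: "\<And>M. regular_maximal M \<Longrightarrow> enat (ord M I) \<le> val M a"
  shows "a \<in> I"
proof -
  interpret I: ideal I R by (rule regular_ideal_ideal[OF I])
  define T where "T = {t \<in> carrier R. a \<otimes> t \<in> I}"
  have T: "ideal T R"
  proof (rule cring_idealI)
    fix r x assume "r \<in> carrier R" "x \<in> T"
    moreover from this have "a \<otimes> (r \<otimes> x) = r \<otimes> (a \<otimes> x)"
      using a by (simp add: T_def m_lcomm)
    ultimately show "r \<otimes> x \<in> T" by (simp add: T_def I.I_l_closed)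
  qed (auto simp: T_def a r_distr)
  have IT: "I \<subseteq> T" using I.I_l_closed a by (auto simp: T_def)
  have "T = carrier R"
  proof (rule ccontr)
    assume "T \<noteq> carrier R"
    then obtain M where M: "regular_maximal M" "T \<subseteq> M"
      using ex_regular_maximal[OF regular_ideal_mono[OF I T IT]] by blast
    obtain y where y: "y \<in> I \<inter> Reg R" "val M y = enat (ord M I)"
      using regular_ord_attained[OF M(1) I] by blast
    then obtain t b where "t \<in> carrier R - M" "b \<in> carrier R" "a \<otimes> t = b \<otimes> y"
      using val_divides[OF M(1) a, of y] le[OF M(1)] by auto
    then have "t \<in> T" "t \<notin> M" using y(1) I.I_l_closed by (auto simp: T_def)
    then show False using M(2) by blast
  qed
  then have "\<one> \<in> T" by simp
  then show ?thesis using a by (simp add: T_def)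
qed

lemma regular_subsetI:
  assumes "regular_ideal J R" "I \<subseteq> carrier R"
    and "\<And>M. regular_maximal M \<Longrightarrow> ord M J \<le> ord M I"
  shows "I \<subseteq> J"
proof
  fix x assume x: "x \<in> I"
  have "enat (ord M J) \<le> val M x" if "regular_maximal M" for M
    by (rule order_trans[OF _ ord_le_val[OF x]]) (simp add: assms(3) that)
  then show "x \<in> J" by (rule regular_memI[OF assms(1) subsetD[OF assms(2) x]])
qed

lemma regular_ideal_eqI:
  assumes "regular_ideal I R" "regular_ideal J R"
    and "\<And>M. regular_maximal M \<Longrightarrow> ord M I = ord M J"
  shows "I = J"
proof (rule subset_antisym)
  show "I \<subseteq> J"
    by (rule regular_subsetI[OF assms(2) regular_ideal_subset[OF assms(1)]]) (simp add: assms(3))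
  show "J \<subseteq> I"
    by (rule regular_subsetI[OF assms(1) regular_ideal_subset[OF assms(2)]]) (simp add: assms(3))
qed

text \<open>If \<open>r \<in> P \<subseteq> M\<close> is regular, then every element of \<open>M\<close> has a power of value at least that of \<open>r\<close>.
That power lies in \<open>P\<close> up to a factor outside \<open>M\<close>, hence in \<open>P\<close>.\<close>

lemma regular_prime_maximal:
  assumes P: "primeideal P R" and reg: "P \<inter> Reg R \<noteq> {}"
  shows "regular_maximal P"
proof -
  interpret P: primeideal P R by (rule P)
  have rP: "regular_ideal P R" using reg P.is_ideal by (simp add: regular_ideal_def)
  obtain M where M: "regular_maximal M" "P \<subseteq> M"
    using ex_regular_maximal[OF rP] P.I_notcarr by blast
  obtain r where r: "r \<in> P" "r \<in> Reg R" using reg by blast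
  obtain n where n: "val M r = enat n" using val_Reg[OF M(1) r(2)] by auto
  have "M \<subseteq> P"
  proof
    fix a assume a: "a \<in> M"
    then have aR: "a \<in> carrier R" by (rule ideal.Icarr[OF regular_maximal_ideal[OF M(1)]])
    have "1 \<le> val M a"
      using val_eq_0_iff[OF M(1) aR] a by (simp add: enat_one_le_iff)
    then have "val M r \<le> val M (a [^] n)"
      unfolding val_pow[OF M(1) aR] n using mult_left_mono[of 1 "val M a" "of_nat n"]
      by (simp add: of_nat_eq_enat)
    then obtain t b where t: "t \<in> carrier R - M" "b \<in> carrier R" "a [^] n \<otimes> t = b \<otimes> r"
      using val_divides[OF M(1) _ r(2), of "a [^] n"] aR by auto
    then have "a [^] n \<otimes> t \<in> P" using r(1) P.I_l_closed by simp
    then have "a [^] n \<in> P" using P.I_prime[of "a [^] n" t] t aR M(2) by auto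
    then show "a \<in> P" by (rule prime_pow[OF P aR])
  qed
  then show ?thesis using M by (simp add: subset_antisym)
qed

lemma ord_carrier: "regular_maximal M \<Longrightarrow> ord M (carrier R) = 0"
  using ord_eq_0_iff[of M "carrier R"] one_notin_regular_maximal[of M]
    regular_idealD[OF regular_ideal_carrier] by auto

lemma ord_prod:
  assumes M: "regular_maximal M" and I: "regular_ideal I R" and J: "regular_ideal J R"
  shows "ord M (I \<cdot> J) = ord M I + ord M J"
proof (rule antisym)
  obtain x where x: "x \<in> I" "val M x = enat (ord M I)"
    using ord_attained[OF M regular_idealD[OF I]] by blast
  obtain y where y: "y \<in> J" "val M y = enat (ord M J)"
    using ord_attained[OF M regular_idealD[OF J]] by blast
  have xy: "x \<in> carrier R" "y \<in> carrier R"
    using regular_ideal_subset[OF I] regular_ideal_subset[OF J] x y by auto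
  have "enat (ord M (I \<cdot> J)) \<le> val M (x \<otimes> y)"
    using x(1) y(1) by (intro ord_le_val ideal_prod.prod)
  then show "ord M (I \<cdot> J) \<le> ord M I + ord M J"
    using val_mult[OF M xy] x y by simp
  have "enat (ord M I + ord M J) \<le> val M z \<and> z \<in> carrier R" if "z \<in> I \<cdot> J" for z
    using that
  proof (induction rule: ideal_prod.induct)
    case (prod i j)
    then have "i \<in> carrier R" "j \<in> carrier R"
      using regular_ideal_subset[OF I] regular_ideal_subset[OF J] by auto
    moreover have "enat (ord M I) + enat (ord M J) \<le> val M i + val M j"
      using prod by (intro add_mono ord_le_val)
    ultimately show ?case by (simp add: val_mult[OF M])
  next
    case (sum s1 s2)
    then have "enat (ord M I + ord M J) \<le> min (val M s1) (val M s2)" by simp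
    then show ?case using val_add[OF M, of s1 s2] sum by (meson a_closed order_trans)
  qed
  then show "ord M I + ord M J \<le> ord M (I \<cdot> J)"
    using le_ord_iff[OF M regular_idealD[OF regular_ideal_prod[OF I J]]] by blast
qed

lemma val_eq_ord_cgenideal:
  assumes M: "regular_maximal M" and r: "r \<in> Reg R"
  shows "val M r = enat (ord M (PIdl r))"
proof (rule antisym)
  obtain x where x: "x \<in> PIdl r" "val M x = enat (ord M (PIdl r))"
    using ord_attained[OF M regular_idealD[OF regular_ideal_cgenideal[OF r]]] by blast
  then obtain a where "a \<in> carrier R" "x = a \<otimes> r" by (auto simp: cgenideal_def)
  then have "val M r \<le> val M x" using val_mult[OF M, of a r] Reg_closed[OF r] by simp
  then show "val M r \<le> enat (ord M (PIdl r))" using x by simp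
  show "enat (ord M (PIdl r)) \<le> val M r"
    using ord_le_val cgenideal_self[OF Reg_closed[OF r]] by blast
qed

lemma ord_maximal_self:
  assumes M: "regular_maximal M"
  shows "ord M M = 1"
proof -
  obtain y where y: "y \<in> Reg R" "val M y = 1" using uniformizer[OF M] by blast
  then have "y \<in> M" using val_eq_0_iff[OF M, of y] Reg_closed by force
  then have "ord M M \<le> 1" using ord_le_val[of y M M] y(2) by (simp add: one_enat_def)
  moreover have "ord M M \<noteq> 0"
    using ord_eq_0_iff[OF M regular_idealD regular_ideal_subset,
        OF regular_maximal_regular[OF M] regular_maximal_regular[OF M]] by simp
  ultimately show ?thesis by simp
qed

lemma ord_maximal_other:
  assumes "regular_maximal M" "regular_maximal N" "M \<noteq> N"
  shows "ord N M = 0"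
proof -
  have "maximalideal M R" using assms(1) by (simp add: regular_maximal_def)
  moreover have "N \<noteq> carrier R" using one_notin_regular_maximal[OF assms(2)] by auto
  ultimately have "\<not> M \<subseteq> N"
    using maximalideal.I_maximal[of M R N] assms(3) regular_maximal_ideal[OF assms(2)]
      ideal_subset[OF regular_maximal_ideal[OF assms(2)]] by auto
  then show ?thesis
    using ord_eq_0_iff[OF assms(2) regular_idealD regular_ideal_subset,
        OF regular_maximal_regular[OF assms(1)] regular_maximal_regular[OF assms(1)]] by simp
qed

lemma ord_ideal_pow:
  "regular_maximal M \<Longrightarrow> regular_ideal I R \<Longrightarrow> ord M (I [^]\<^bsub>ideals_set R\<^esub> (n :: nat)) = n * ord M I"
  by (induction n)
    (simp_all add: ideals_set_one ideals_set_mult ord_carrier ord_prod regular_ideal_pow)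

text \<open>By the local criterion for membership, since powers of \<open>M\<close> have order 0 at all other maximal
ideals.\<close>

lemma mem_maximal_pow_iff:
  assumes M: "regular_maximal M" and x: "x \<in> carrier R"
  shows "x \<in> M [^]\<^bsub>ideals_set R\<^esub> (n :: nat) \<longleftrightarrow> enat n \<le> val M x"
proof
  note reg = regular_maximal_regular[OF M]
  show "enat n \<le> val M x" if "x \<in> M [^]\<^bsub>ideals_set R\<^esub> n"
    using ord_le_val[OF that, of M] by (simp add: ord_ideal_pow[OF M reg] ord_maximal_self[OF M])
  assume le: "enat n \<le> val M x"
  show "x \<in> M [^]\<^bsub>ideals_set R\<^esub> n"
  proof (rule regular_memI[OF regular_ideal_pow[OF reg] x])
    fix N assume N: "regular_maximal N"
    show "enat (ord N (M [^]\<^bsub>ideals_set R\<^esub> n)) \<le> val N x"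
    proof (cases "N = M")
      case True
      then show ?thesis using le by (simp add: ord_ideal_pow[OF M reg] ord_maximal_self[OF M])
    next
      case False
      then show ?thesis
        using ord_maximal_other[OF M N] by (simp add: ord_ideal_pow[OF N reg] zero_enat_def[symmetric])
    qed
  qed
qed

lemma V_pow_eq:
  assumes E: "E \<subseteq> carrier R" "E \<inter> Reg R \<noteq> {}" and n: "1 \<le> n"
  shows "V_pow R n E = {M. regular_maximal M \<and> n \<le> ord M E}"
proof -
  have pow: "E \<subseteq> M [^]\<^bsub>ideals_set R\<^esub> n \<longleftrightarrow> n \<le> ord M E" if M: "regular_maximal M" for M
    using mem_maximal_pow_iff[OF M, of _ n] E(1) by (auto simp: le_ord_iff[OF M E(2)])
  have maximal: "regular_maximal P"
    if P: "primeideal P R" "E \<subseteq> P [^]\<^bsub>ideals_set R\<^esub> n" for P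
  proof -
    have "E \<subseteq> P" using ideal_pow_subset[OF primeideal.axioms(1)[OF P(1)] n] P(2) by simp
    then have "P \<inter> Reg R \<noteq> {}" using E(2) by blast
    then show ?thesis by (rule regular_prime_maximal[OF P(1)])
  qed
  show ?thesis
  proof (rule Set.set_eqI)
    fix P
    show "P \<in> V_pow R n E \<longleftrightarrow> P \<in> {M. regular_maximal M \<and> n \<le> ord M E}"
      using pow[of P] maximal[of P] regular_maximal_prime[of P] by (auto simp: V_pow_def Spec_def)
  qed
qed

lemma V_pow_regular_ideal:
  "regular_ideal I R \<Longrightarrow> 1 \<le> n \<Longrightarrow> V_pow R n I = {M. regular_maximal M \<and> n \<le> ord M I}"
  by (intro V_pow_eq regular_ideal_subset regular_idealD)

lemma V_pow_singleton:
  "r \<in> Reg R \<Longrightarrow> 1 \<le> n \<Longrightarrow> V_pow R n {r} = {M. regular_maximal M \<and> enat n \<le> val M r}"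
  using V_pow_eq[of "{r}" n] le_ord_iff[of _ "{r}" n] Reg_closed[of r] by auto

end


section \<open>Radical factorizations\<close>

lemma length_filter_upt: "n \<le> k \<Longrightarrow> length (filter (\<lambda>i. Suc i \<le> n) [0..<k]) = n"
proof -
  assume "n \<le> k"
  then have "[0..<k] = [0..<n] @ [n..<k]" using upt_add_eq_append[of 0 n "k - n"] by simp
  moreover have "filter (\<lambda>i. Suc i \<le> n) [0..<n] = [0..<n]" by (auto simp: filter_id_conv)
  moreover have "filter (\<lambda>i. Suc i \<le> n) [n..<k] = []" by (auto simp: filter_empty_conv)
  ultimately show ?thesis by simp
qed

context marot_N_ring
begin


text \<open>If \<open>y\<close> has value 1 at \<open>M\<close> and \<open>n = ord M J\<close>, then \<open>y\<^sup>n\<close> lies in \<open>J\<close> up to a factor outside \<open>M\<close>, and so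
does \<open>y\<close> because \<open>J\<close> is radical.\<close>

lemma radical_ord_le_1:
  assumes J: "radical_ideal J R" "regular_ideal J R" and M: "regular_maximal M"
  shows "ord M J \<le> 1"
proof (cases "ord M J = 0")
  case False
  define n where "n = ord M J"
  have n: "1 \<le> n" using False by (simp add: n_def)
  obtain r where r: "r \<in> J \<inter> Reg R" "val M r = enat n"
    using regular_ord_attained[OF M J(2)] by (auto simp: n_def)
  obtain y where y: "y \<in> Reg R" "val M y = 1" using uniformizer[OF M] by blast
  note yR = Reg_closed[OF y(1)]
  have "val M r \<le> val M (y [^] n)"
    using r y by (simp add: val_pow[OF M yR] of_nat_eq_enat)
  then obtain t b where t: "t \<in> carrier R - M" "b \<in> carrier R" "y [^] n \<otimes> t = b \<otimes> r"
    using val_divides[OF M _ , of "y [^] n" r] yR r(1) by auto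
  obtain m where m: "n = Suc m" using n by (cases n) auto
  have "(y \<otimes> t) [^] n = (y [^] n \<otimes> t) \<otimes> t [^] m"
    using yR t(1) by (simp add: m nat_pow_distrib m_ac)
  moreover have "y [^] n \<otimes> t \<in> J"
    using ideal.I_l_closed[OF regular_ideal_ideal[OF J(2)], of r b] r(1) t by simp
  ultimately have "(y \<otimes> t) [^] n \<in> J"
    using ideal.I_r_closed[OF regular_ideal_ideal[OF J(2)]] t(1) by simp
  then have "y \<otimes> t \<in> J"
    using radical_idealD[OF J(1) _ _ n] yR t(1) by simp
  moreover have "val M (y \<otimes> t) = 1"
    using val_mult[OF M yR] val_eq_0_iff[OF M] t(1) y(2) by simp
  ultimately show ?thesis using ord_le_val[of "y \<otimes> t" J M] by (simp add: one_enat_def)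
qed simp

lemma radical_ord:
  assumes "radical_ideal J R" "regular_ideal J R" "regular_maximal M"
  shows "ord M J = (if J \<subseteq> M then 1 else 0)"
  using radical_ord_le_1[OF assms]
    ord_eq_0_iff[OF assms(3) regular_idealD regular_ideal_subset, OF assms(2,2)]
  by auto

lemma radical_eqI:
  assumes J: "radical_ideal J R" "regular_ideal J R" and K: "radical_ideal K R" "regular_ideal K R"
    and "\<And>M. M \<in> Spec R \<Longrightarrow> J \<subseteq> M \<longleftrightarrow> K \<subseteq> M"
  shows "J = K"
proof (rule regular_ideal_eqI[OF J(2) K(2)])
  fix M assume M: "regular_maximal M"
  then have "M \<in> Spec R" using regular_maximal_prime by (simp add: Spec_def)
  then show "ord M J = ord M K" using radical_ord[OF J M] radical_ord[OF K M] assms(5) by simp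
qed

lemma ord_list_prod:
  assumes "\<forall>J \<in> set Js. radical_ideal J R \<and> regular_ideal J R" and M: "regular_maximal M"
  shows "ord M (ideal_list_prod R Js) = length (filter (\<lambda>J. J \<subseteq> M) Js)
    \<and> regular_ideal (ideal_list_prod R Js) R"
  using assms(1)
  by (induction Js)
    (simp_all add: ideal_list_prod_Nil ideal_list_prod_Cons ord_carrier[OF M] ord_prod[OF M]
      radical_ord[OF _ _ M] regular_ideal_carrier regular_ideal_prod)

text \<open>The order of a product of radical ideals at \<open>M\<close> counts the factors contained in \<open>M\<close>. The right-hand
side ranges over all primes, but for \<open>n \<ge> 1\<close> a prime occurring in it contains a regular ideal.\<close>

lemma V_pow_list_prod:
  assumes rad: "\<forall>J \<in> set Js. radical_ideal J R"
    and I: "regular_ideal I R" "I = ideal_list_prod R Js" and n: "1 \<le> n"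
  shows "V_pow R n I = {P \<in> Spec R. n \<le> length (filter (\<lambda>J. J \<subseteq> P) Js)}"
proof -
  have reg: "\<forall>J \<in> set Js. radical_ideal J R \<and> regular_ideal J R"
    using regular_factors rad I by simp
  have "regular_maximal P" if P: "P \<in> Spec R" "n \<le> length (filter (\<lambda>J. J \<subseteq> P) Js)" for P
  proof -
    have "filter (\<lambda>J. J \<subseteq> P) Js \<noteq> []" using P(2) n by auto
    then obtain J where "J \<in> set Js" "J \<subseteq> P" by (auto simp: filter_empty_conv)
    then have "P \<inter> Reg R \<noteq> {}" using reg regular_idealD[of J] by blast
    then show ?thesis using regular_prime_maximal P(1) by (simp add: Spec_def)
  qed
  moreover have "P \<in> Spec R" if "regular_maximal P" for P
    using regular_maximal_prime[OF that] by (simp add: Spec_def)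
  ultimately show ?thesis
    unfolding V_pow_regular_ideal[OF I(1) n] using ord_list_prod[OF reg] I(2) by auto
qed

lemma V_pow_list_prod_empty:
  assumes rad: "\<forall>J \<in> set Js. radical_ideal J R"
    and I: "regular_ideal I R" "I = ideal_list_prod R Js"
  shows "V_pow R (Suc (length Js)) I = {}"
  using V_pow_list_prod[OF assms, of "Suc (length Js)"] length_filter_le[of _ Js]
  by (auto simp: not_less_eq_eq[symmetric])

lemma closed_V_pow_list_prod:
  assumes rad: "\<forall>J \<in> set Js. radical_ideal J R"
    and I: "regular_ideal I R" "I = ideal_list_prod R Js" and n: "1 \<le> n"
  shows "closedin (Zariski R) (V_pow R n I)"
proof -
  have "\<forall>J \<in> set Js. J \<subseteq> carrier R" using rad ideal_subset by (simp add: radical_ideal_def)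
  then show ?thesis unfolding V_pow_list_prod[OF assms] by (rule closedin_count)
qed

text \<open>The factors of a chain are recovered from the product, by intersecting the superlevel sets of its
order function; the number of proper factors is recovered because those sets are nonempty exactly up
to the length of the chain.\<close>

lemma chain_factor:
  assumes I: "regular_ideal I R" "I = ideal_list_prod R Js"
    and rad: "\<forall>J \<in> set Js. radical_ideal J R" and chain: "sorted_wrt (\<subseteq>) Js"
    and n: "n < length Js"
  shows "Js ! n = carrier R \<inter> \<Inter>(V_pow R (Suc n) I)"
    and "Js ! n \<noteq> carrier R \<Longrightarrow> V_pow R (Suc n) I \<noteq> {}"
proof -
  let ?J = "Js ! n"
  have J: "radical_ideal ?J R" "regular_ideal ?J R"
    using regular_factors rad I n nth_mem by auto
  have n1: "1 \<le> Suc n" by simp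
  have V: "V_pow R (Suc n) I = {P \<in> Spec R. ?J \<subseteq> P}"
    unfolding V_pow_list_prod[OF rad I n1] using count_chain[OF chain n] by (auto simp: Suc_le_eq)
  have closed: "closedin (Zariski R) (V_pow R (Suc n) I)"
    by (rule closed_V_pow_list_prod[OF rad I n1])
  note K = ideal_of_closed[OF I(1) closed V_pow_subset[OF I(1) n1]]
  show "?J = carrier R \<inter> \<Inter>(V_pow R (Suc n) I)"
    by (rule radical_eqI[OF J K(1,2)]) (simp_all add: K(3), simp add: V)
  assume "?J \<noteq> carrier R"
  then obtain M where "regular_maximal M" "?J \<subseteq> M" using ex_regular_maximal[OF J(2)] by blast
  then have "M \<in> V_pow R (Suc n) I" using regular_maximal_prime unfolding V by (simp add: Spec_def)
  then show "V_pow R (Suc n) I \<noteq> {}" by blast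
qed

lemma chain_factorization_unique:
  assumes I: "regular_ideal I R"
    and Js: "I = ideal_list_prod R Js" "\<forall>J \<in> set Js. radical_ideal J R \<and> J \<noteq> carrier R"
      "sorted_wrt (\<subseteq>) Js"
    and Ks: "I = ideal_list_prod R Ks" "\<forall>J \<in> set Ks. radical_ideal J R \<and> J \<noteq> carrier R"
      "sorted_wrt (\<subseteq>) Ks"
  shows "Js = Ks"
proof -
  have length: "\<not> length Js < length Ks"
    if Js: "I = ideal_list_prod R Js" "\<forall>J \<in> set Js. radical_ideal J R \<and> J \<noteq> carrier R"
      "sorted_wrt (\<subseteq>) Js"
    and Ks: "I = ideal_list_prod R Ks" "\<forall>J \<in> set Ks. radical_ideal J R \<and> J \<noteq> carrier R"
      "sorted_wrt (\<subseteq>) Ks" for Js Ks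
  proof
    assume less: "length Js < length Ks"
    have "V_pow R (Suc (length Js)) I = {}"
      using V_pow_list_prod_empty[OF _ I Js(1)] Js(2) by simp
    moreover have "V_pow R (Suc (length Js)) I \<noteq> {}"
      using chain_factor(2)[OF I Ks(1) _ Ks(3) less] Ks(2) nth_mem[OF less] by simp
    ultimately show False by simp
  qed
  have "length Js = length Ks" using length[OF Js Ks] length[OF Ks Js] by simp
  then show ?thesis
  proof (rule nth_equalityI)
    fix i assume "i < length Js"
    then show "Js ! i = Ks ! i"
      using chain_factor(1)[OF I Js(1) _ Js(3)] chain_factor(1)[OF I Ks(1) _ Ks(3)] Js(2) Ks(2)
        \<open>length Js = length Ks\<close> by simp
  qed
qed

text \<open>The factors are the radical ideals of \<open>V\<^sub>1(I), \<dots>, V\<^sub>k(I)\<close>, where \<open>k\<close> is the largest value of the order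
function of \<open>I\<close>; the order at \<open>M\<close> of their product is the number of \<open>i \<le> k\<close> with \<open>i \<le> ord M I\<close>.\<close>

lemma closed_V_pow_imp_chain_factorization:
  assumes I: "regular_ideal I R" "I \<noteq> carrier R"
    and closed: "\<And>n. 1 \<le> n \<Longrightarrow> closedin (Zariski R) (V_pow R n I)"
    and empty: "V_pow R m I = {}" "1 \<le> m"
  shows "\<exists>Js. Js \<noteq> [] \<and> (\<forall>J \<in> set Js. radical_ideal J R \<and> J \<noteq> carrier R) \<and>
    sorted_wrt (\<subseteq>) Js \<and> I = ideal_list_prod R Js"
proof -
  define k where "k = (LEAST k. V_pow R (Suc k) I = {})"
  have V: "V_pow R (Suc n) I = {M. regular_maximal M \<and> Suc n \<le> ord M I}" for n
    by (rule V_pow_regular_ideal[OF I(1)]) simp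
  have k: "V_pow R (Suc k) I = {}"
    unfolding k_def by (rule LeastI[of _ "m - 1"]) (use empty in simp)
  have less_k: "V_pow R (Suc i) I \<noteq> {}" if "i < k" for i
    using not_less_Least[of i] that unfolding k_def by blast
  obtain M where M: "regular_maximal M" "I \<subseteq> M" using ex_regular_maximal[OF I] .
  have "ord M I \<noteq> 0"
    using ord_eq_0_iff[OF M(1) regular_idealD[OF I(1)] regular_ideal_subset[OF I(1)]] M(2) by simp
  then have "k \<noteq> 0" using k V[of 0] M(1) by (intro notI) auto
  define J where "J i = carrier R \<inter> \<Inter>(V_pow R (Suc i) I)" for i
  have n1: "1 \<le> Suc i" for i by simp
  have J_props: "radical_ideal (J i) R" "regular_ideal (J i) R"
    "\<And>P. P \<in> Spec R \<Longrightarrow> J i \<subseteq> P \<longleftrightarrow> P \<in> V_pow R (Suc i) I" for i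
    using ideal_of_closed[OF I(1) closed[OF n1] V_pow_subset[OF I(1) n1], of i]
    by (simp_all add: J_def)
  have J_proper: "J i \<noteq> carrier R" if "i < k" for i
  proof -
    obtain P where P: "P \<in> V_pow R (Suc i) I" using less_k[OF \<open>i < k\<close>] by blast
    then have "J i \<subseteq> P" "P \<in> Spec R" by (auto simp: J_def V_pow_def)
    then show ?thesis
      using primeideal.I_notcarr[of P R] ideal_subset[of P] primeideal.axioms(1)[of P R]
      by (auto simp: Spec_def)
  qed
  define Js where "Js = map J [0..<k]"
  have J_mono: "J i \<subseteq> J j" if "i \<le> j" for i j
  proof -
    have "V_pow R (Suc j) I \<subseteq> V_pow R (Suc i) I" unfolding V using that by auto
    then show ?thesis by (auto simp: J_def)
  qed
  have chain: "sorted_wrt (\<subseteq>) Js"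
    unfolding Js_def sorted_wrt_map
    by (rule sorted_wrt_mono_rel[OF _ sorted_wrt_upt]) (simp add: J_mono)
  have reg: "\<forall>J \<in> set Js. radical_ideal J R \<and> regular_ideal J R"
    using J_props(1,2) by (auto simp: Js_def)
  have "I = ideal_list_prod R Js"
  proof (rule regular_ideal_eqI[OF I(1)])
    fix M assume M: "regular_maximal M"
    then have spec: "M \<in> Spec R" using regular_maximal_prime by (simp add: Spec_def)
    have "ord M I \<le> k" using k M unfolding V by (auto simp: not_less_eq_eq)
    have "filter (\<lambda>J. J \<subseteq> M) Js = map J (filter (\<lambda>i. Suc i \<le> ord M I) [0..<k])"
      unfolding Js_def filter_map comp_def J_props(3)[OF spec] V using M by simp
    then show "ord M I = ord M (ideal_list_prod R Js)"
      using ord_list_prod[OF reg M] length_filter_upt[OF \<open>ord M I \<le> k\<close>] by simp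
  next
    obtain M where "regular_maximal M" using M by blast
    then show "regular_ideal (ideal_list_prod R Js) R" using ord_list_prod[OF reg] by blast
  qed
  moreover have "Js \<noteq> []" using \<open>k \<noteq> 0\<close> by (simp add: Js_def)
  moreover have "\<forall>J \<in> set Js. radical_ideal J R \<and> J \<noteq> carrier R"
    using J_props(1) J_proper by (auto simp: Js_def)
  ultimately show ?thesis using chain by blast
qed

end


section \<open>Finitely generated regular ideals\<close>

context marot_N_ring
begin


text \<open>Each generator is divisible by \<open>y\<close> up to a factor outside \<open>M\<close>; for finitely many generators the
product of these factors serves for the whole ideal.\<close>

lemma clear_denominators:
  assumes M: "regular_maximal M" and y: "y \<in> Reg R" and S: "finite S" "S \<subseteq> carrier R"
    and le: "\<forall>x \<in> S. val M y \<le> val M x"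
  shows "\<exists>t \<in> carrier R - M. \<forall>x \<in> Idl S. t \<otimes> x \<in> PIdl y"
proof -
  note PI = cgenideal_ideal[OF Reg_closed[OF y]]
  have "\<exists>t \<in> carrier R - M. \<forall>x \<in> S. t \<otimes> x \<in> PIdl y"
    using S le
  proof (induction S rule: finite_induct)
    case empty
    show ?case using one_notin_regular_maximal[OF M] by auto
  next
    case (insert x S)
    then obtain t where t: "t \<in> carrier R - M" "\<forall>x \<in> S. t \<otimes> x \<in> PIdl y" by auto
    obtain t' b where t': "t' \<in> carrier R - M" "b \<in> carrier R" "x \<otimes> t' = b \<otimes> y"
      using val_divides[OF M _ y, of x] insert.prems by auto
    have "(t \<otimes> t') \<otimes> z \<in> PIdl y" if z: "z \<in> insert x S" for z
    proof (cases "z = x")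
      case True
      have "(t \<otimes> t') \<otimes> x = t \<otimes> (x \<otimes> t')"
        using t(1) t'(1) insert.prems(1) by (simp add: m_ac)
      moreover have "x \<otimes> t' \<in> PIdl y" using t' by (auto simp: cgenideal_def)
      ultimately show ?thesis using True ideal.I_l_closed[OF PI] t(1) by simp
    next
      case False
      then have "z \<in> S" "z \<in> carrier R" using z insert.prems by auto
      moreover have "(t \<otimes> t') \<otimes> z = t' \<otimes> (t \<otimes> z)"
        using t(1) t'(1) calculation by (simp add: m_ac)
      ultimately show ?thesis using t(2) t'(1) ideal.I_l_closed[OF PI] by simp
    qed
    then show ?case using regular_maximal_mult[OF M t(1) t'(1)] by blast
  qed
  then obtain t where t: "t \<in> carrier R - M" "\<forall>x \<in> S. t \<otimes> x \<in> PIdl y" by blast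
  have "ideal {x \<in> carrier R. t \<otimes> x \<in> PIdl y} R"
  proof (rule cring_idealI)
    fix r x assume "r \<in> carrier R" "x \<in> {x \<in> carrier R. t \<otimes> x \<in> PIdl y}"
    moreover from this have "t \<otimes> (r \<otimes> x) = r \<otimes> (t \<otimes> x)" using t(1) by (simp add: m_lcomm)
    ultimately show "r \<otimes> x \<in> {x \<in> carrier R. t \<otimes> x \<in> PIdl y}"
      using ideal.I_l_closed[OF PI] by simp
  qed (use t(1) additive_subgroup.zero_closed[OF ideal.axioms(1)[OF PI]]
      additive_subgroup.a_closed[OF ideal.axioms(1)[OF PI]] in \<open>auto simp: r_distr\<close>)
  then have "Idl S \<subseteq> {x \<in> carrier R. t \<otimes> x \<in> PIdl y}"
    using S(2) t(2) by (intro genideal_minimal) auto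
  then show ?thesis using t(1) by blast
qed

text \<open>Near \<open>M\<close> a regular finitely generated ideal is principal, generated by a regular element of minimal
value.\<close>

lemma clear_denominators_ideal:
  assumes M: "regular_maximal M" and I: "regular_ideal I R" "fin_gen_ideal I R"
  obtains y t where "y \<in> I" "y \<in> Reg R" "val M y = enat (ord M I)"
    "t \<in> carrier R - M" "\<forall>x \<in> I. t \<otimes> x \<in> PIdl y"
proof -
  obtain y where y: "y \<in> I \<inter> Reg R" "val M y = enat (ord M I)"
    using regular_ord_attained[OF M I(1)] by blast
  obtain S where S: "S \<subseteq> carrier R" "finite S" "I = Idl S"
    using I(2) unfolding fin_gen_ideal_def by blast
  have "\<forall>x \<in> S. val M y \<le> val M x"
    using genideal_self[OF S(1)] S(3) y(2) ord_le_val[of _ I M] by auto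
  then obtain t where "t \<in> carrier R - M" "\<forall>x \<in> I. t \<otimes> x \<in> PIdl y"
    using clear_denominators[OF M _ S(2,1), of y] y(1) S(3) by auto
  then show thesis using that[of y t] y by simp
qed

text \<open>The complementary factor is the conductor \<open>(r) : I\<close>. Its order at \<open>M\<close> is the expected difference
\<open>v\<^sub>M(r) - ord M I\<close>, because \<open>I\<close> is principal near \<open>M\<close>; finite generation is needed for that.\<close>

lemma fin_gen_imp_invertible:
  assumes I: "regular_ideal I R" "fin_gen_ideal I R" and r: "r \<in> I" "r \<in> Reg R"
  shows "\<exists>B. ideal B R \<and> I \<cdot> B = PIdl r"
proof -
  note II = regular_ideal_ideal[OF I(1)]
  note IR = ideal.Icarr[OF II] and rR = Reg_closed[OF r(2)]
  note PI = cgenideal_ideal[OF rR]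
  define B where "B = {b \<in> carrier R. \<forall>x \<in> I. b \<otimes> x \<in> PIdl r}"
  have B: "ideal B R"
  proof (rule cring_idealI)
    show "B \<subseteq> carrier R" by (auto simp: B_def)
    show "\<zero> \<in> B"
      using additive_subgroup.zero_closed[OF ideal.axioms(1)[OF PI]] IR by (simp add: B_def)
    show "x \<oplus> y \<in> B" if "x \<in> B" "y \<in> B" for x y
      using that additive_subgroup.a_closed[OF ideal.axioms(1)[OF PI]] IR
      by (simp add: B_def l_distr)
    show "a \<otimes> x \<in> B" if "a \<in> carrier R" "x \<in> B" for a x
      using that ideal.I_l_closed[OF PI] IR by (simp add: B_def m_assoc)
  qed
  have "r \<in> B" using rR IR m_comm by (auto simp: B_def cgenideal_def)
  then have regB: "regular_ideal B R" using B r(2) by (auto simp: regular_ideal_def)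
  have "I \<cdot> B \<subseteq> PIdl r"
  proof
    fix s assume "s \<in> I \<cdot> B"
    then show "s \<in> PIdl r"
    proof (induction rule: ideal_prod.induct)
      case (prod i j)
      then have "j \<otimes> i \<in> PIdl r" "j \<in> carrier R" by (simp_all add: B_def)
      then show ?case using IR[OF prod(1)] m_comm by simp
    next
      case (sum s1 s2)
      then show ?case using additive_subgroup.a_closed[OF ideal.axioms(1)[OF PI]] by simp
    qed
  qed
  moreover have "PIdl r \<subseteq> I \<cdot> B"
  proof (rule regular_subsetI[OF regular_ideal_prod[OF I(1) regB] ideal_subset[OF PI]])
    fix M assume M: "regular_maximal M"
    obtain y t where y: "y \<in> I" "y \<in> Reg R" "val M y = enat (ord M I)"
      and t: "t \<in> carrier R - M" "\<forall>x \<in> I. t \<otimes> x \<in> PIdl y"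
      using clear_denominators_ideal[OF M I] .
    have "val M y \<le> val M r" using ord_le_val[OF r(1)] y(3) by simp
    then obtain u d where u: "u \<in> carrier R - M" "d \<in> carrier R" "r \<otimes> u = d \<otimes> y"
      using val_divides[OF M rR y(2)] by auto
    have "d \<otimes> t \<in> B"
      unfolding B_def
    proof (intro CollectI conjI ballI)
      show "d \<otimes> t \<in> carrier R" using u t by simp
      fix x assume x: "x \<in> I"
      obtain c where c: "c \<in> carrier R" "t \<otimes> x = c \<otimes> y" using bspec[OF t(2) x] by (auto simp: cgenideal_def)
      have "(d \<otimes> t) \<otimes> x = d \<otimes> (c \<otimes> y)" using u t IR[OF x] c by (simp add: m_assoc)
      also have "\<dots> = c \<otimes> (r \<otimes> u)" using u c Reg_closed[OF y(2)] by (simp add: m_lcomm)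
      also have "\<dots> = (c \<otimes> u) \<otimes> r" using u c rR by (simp add: m_ac)
      finally show "(d \<otimes> t) \<otimes> x \<in> PIdl r" using c u by (auto simp: cgenideal_def)
    qed
    then have "enat (ord M B) \<le> val M (d \<otimes> t)" by (rule ord_le_val)
    moreover have "val M t = 0" "val M u = 0" using val_eq_0_iff[OF M] t(1) u(1) by auto
    ultimately have "enat (ord M B) \<le> val M d" using val_mult[OF M, of d t] u t by simp
    moreover have "val M r = val M d + enat (ord M I)"
      using val_mult[OF M rR, of u] val_mult[OF M u(2), of y] u \<open>val M u = 0\<close> y Reg_closed
      by simp
    ultimately have "enat (ord M I) + enat (ord M B) \<le> val M r"
      by (metis add.commute add_left_mono)
    then show "ord M (I \<cdot> B) \<le> ord M (PIdl r)"
      using val_eq_ord_cgenideal[OF M r(2)] by (simp add: ord_prod[OF M I(1) regB])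
  qed
  ultimately show ?thesis using B by blast
qed

text \<open>The radical of \<open>I\<close> is a factor of the invertible ideal \<open>I\<close>.\<close>

lemma radical_fin_gen:
  assumes I: "regular_ideal I R" "fin_gen_ideal I R"
    and Js: "\<forall>J \<in> set Js. radical_ideal J R" "sorted_wrt (\<subseteq>) Js" "I = ideal_list_prod R Js" "Js \<noteq> []"
  shows "fin_gen_ideal (ideal_radical R I) R"
proof -
  obtain J Ks where Js_eq: "Js = J # Ks" using Js(4) by (cases Js) auto
  have J: "ideal_radical R I = J"
    using radical_of_chain_prod[of J Ks] Js by (simp add: Js_eq)
  obtain r where r: "r \<in> I" "r \<in> Reg R" using regular_idealD[OF I(1)] by blast
  obtain B where B: "ideal B R" "I \<cdot> B = PIdl r" using fin_gen_imp_invertible[OF I r] by blast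
  have ideals: "ideal J R" "ideal (ideal_list_prod R Ks) R"
    using Js(1) ideal_list_prod_ideal[of Ks] by (simp_all add: Js_eq radical_ideal_def)
  have "J \<cdot> (ideal_list_prod R Ks \<cdot> B) = PIdl r"
    using B Js(3) ideal_prod_assoc[OF ideals B(1)] by (simp add: Js_eq ideal_list_prod_Cons)
  then have "fin_gen_ideal J R"
    by (rule invertible_imp_fin_gen[OF ideals(1) ideal_prod_is_ideal[OF ideals(2) B(1)] r(2)])
  then show ?thesis by (simp add: J)
qed

text \<open>Upper semicontinuity of the valuation of \<open>r\<close> on the basic open set of \<open>u\<close>. The ideal \<open>J\<close> is generated
near \<open>M\<close> by some \<open>y\<close> of value 1 at \<open>M\<close>; as \<open>J\<close> is radical, \<open>y\<close> has value at most 1 at all nearby \<open>N\<close>. With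
\<open>n = v\<^sub>M(r)\<close>, the element \<open>r\<close> divides \<open>y\<^sup>n\<close> near \<open>M\<close>, so its value there is at most \<open>n\<close>.\<close>

lemma local_bound:
  assumes M: "regular_maximal M" and r: "r \<in> Reg R"
    and J: "J \<subseteq> M" "regular_ideal J R" "fin_gen_ideal J R" "radical_ideal J R"
  obtains u where "u \<in> carrier R - M"
    "\<And>N. regular_maximal N \<Longrightarrow> u \<notin> N \<Longrightarrow> val N r \<le> val M r"
proof -
  obtain y t where y: "y \<in> J" "y \<in> Reg R" "val M y = enat (ord M J)"
    and t: "t \<in> carrier R - M" "\<forall>x \<in> J. t \<otimes> x \<in> PIdl y"
    using clear_denominators_ideal[OF M J(2,3)] .
  have y1: "val M y = 1" using y(3) radical_ord[OF J(4,2) M] J(1) by (simp add: one_enat_def)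
  note yR = Reg_closed[OF y(2)]
  obtain n where n: "val M r = enat n" using val_Reg[OF M r] by auto
  have "val M r \<le> val M (y [^] n)" using n y1 by (simp add: val_pow[OF M yR] of_nat_eq_enat)
  then obtain t' b where t': "t' \<in> carrier R - M" "b \<in> carrier R" "y [^] n \<otimes> t' = b \<otimes> r"
    using val_divides[OF M _ r, of "y [^] n"] yR by auto
  have "val N r \<le> val M r" if N: "regular_maximal N" and u: "t \<otimes> t' \<notin> N" for N
  proof -
    have "t \<notin> N" "t' \<notin> N"
      using u t(1) t'(1) ideal.I_l_closed[OF regular_maximal_ideal[OF N]]
        ideal.I_r_closed[OF regular_maximal_ideal[OF N]] by auto
    then have units: "val N t = 0" "val N t' = 0" using val_eq_0_iff[OF N] t(1) t'(1) by auto
    obtain x where x: "x \<in> J" "val N x = enat (ord N J)"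
      using ord_attained[OF N regular_idealD[OF J(2)]] by blast
    have xR: "x \<in> carrier R" using x(1) regular_ideal_subset[OF J(2)] by blast
    obtain c where c: "c \<in> carrier R" "t \<otimes> x = c \<otimes> y"
      using bspec[OF t(2) x(1)] by (auto simp: cgenideal_def)
    have "val N x = val N c + val N y"
      using val_mult[OF N, of t x] val_mult[OF N c(1) yR] c(2) units t(1) xR by simp
    then have "val N y \<le> val N x" by simp
    also have "\<dots> \<le> 1"
      using x(2) radical_ord_le_1[OF J(4,2) N] by (simp add: one_enat_def)
    finally have y_le: "val N y \<le> 1" .
    have "val N r \<le> val N b + val N r" by simp
    also have "\<dots> = of_nat n * val N y"
      using val_mult[OF N t'(2) Reg_closed[OF r]] val_mult[OF N, of "y [^] n" t'] t' units yR
      by (simp add: val_pow[OF N yR])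
    also have "\<dots> \<le> of_nat n * 1" using y_le by (intro mult_left_mono) simp_all
    finally show ?thesis by (simp add: n of_nat_eq_enat)
  qed
  then show thesis using that regular_maximal_mult[OF M t(1) t'(1)] by blast
qed

text \<open>The complement of \<open>V\<^sub>n(r)\<close> is the union of the basic open sets on which \<open>r\<close> has value below \<open>n\<close>. One of
them is that of \<open>r\<close> itself, and it takes care of the primes that are not regular.\<close>

lemma local_bounds_imp_closed:
  assumes r: "r \<in> Reg R" and n: "1 \<le> n"
    and bound: "\<And>M. regular_maximal M \<Longrightarrow> \<exists>u \<in> carrier R - M.
      \<forall>N. regular_maximal N \<longrightarrow> u \<notin> N \<longrightarrow> val N r \<le> val M r"
  shows "closedin (Zariski R) (V_pow R n {r})"
proof -
  let ?E = "{u \<in> carrier R. \<forall>N. regular_maximal N \<longrightarrow> u \<notin> N \<longrightarrow> val N r < enat n}"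
  have "P \<in> V_pow R n {r} \<longleftrightarrow> P \<in> Spec R \<and> ?E \<subseteq> P" for P
  proof
    assume "P \<in> V_pow R n {r}"
    then have P: "regular_maximal P" "enat n \<le> val P r" using V_pow_singleton[OF r n] by auto
    moreover have "u \<in> P" if "u \<in> ?E" for u
      using that P by (auto simp: not_less[symmetric])
    ultimately show "P \<in> Spec R \<and> ?E \<subseteq> P"
      using regular_maximal_prime by (auto simp: Spec_def)
  next
    assume P: "P \<in> Spec R \<and> ?E \<subseteq> P"
    have "val N r < enat n" if "regular_maximal N" "r \<notin> N" for N
      using val_eq_0_iff[OF that(1) Reg_closed[OF r]] that(2) n by (simp add: zero_enat_def)
    then have "r \<in> ?E" using Reg_closed[OF r] by simp
    then have "P \<inter> Reg R \<noteq> {}" using P r by blast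
    then have M: "regular_maximal P" using regular_prime_maximal P by (simp add: Spec_def)
    obtain u where u: "u \<in> carrier R - P"
      and le: "\<forall>N. regular_maximal N \<longrightarrow> u \<notin> N \<longrightarrow> val N r \<le> val P r" using bound[OF M] by blast
    have "\<not> val P r < enat n"
    proof
      assume "val P r < enat n"
      then have "u \<in> ?E" using le u by (auto intro: le_less_trans)
      then show False using u P by blast
    qed
    then show "P \<in> V_pow R n {r}" using M V_pow_singleton[OF r n] by simp
  qed
  then have "V_pow R n {r} = {P \<in> Spec R. ?E \<subseteq> P}" by auto
  moreover have "?E \<subseteq> carrier R" by auto
  ultimately show ?thesis using closedin_Spec_subset[of ?E R] by simp
qed

text \<open>The quasi-compactness argument in algebraic form: the elements \<open>u\<close> such that \<open>r\<close> has bounded value off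
\<open>V(u)\<close> form an ideal, which contains \<open>r\<close> and lies in no regular maximal ideal, so it contains 1.\<close>

lemma local_bounds_imp_bounded:
  assumes r: "r \<in> Reg R"
    and bound: "\<And>M. regular_maximal M \<Longrightarrow> \<exists>u \<in> carrier R - M.
      \<forall>N. regular_maximal N \<longrightarrow> u \<notin> N \<longrightarrow> val N r \<le> val M r"
  shows "\<exists>m \<ge> 1. V_pow R m {r} = {}"
proof -
  define U where "U = {u \<in> carrier R. \<exists>n. \<forall>N. regular_maximal N \<longrightarrow> u \<notin> N \<longrightarrow> val N r \<le> enat n}"
  have U: "ideal U R"
  proof (rule cring_idealI)
    show "U \<subseteq> carrier R" by (auto simp: U_def)
    show "\<zero> \<in> U"
      using additive_subgroup.zero_closed[OF ideal.axioms(1)[OF regular_maximal_ideal]]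
      by (auto simp: U_def)
  next
    fix x y assume "x \<in> U" "y \<in> U"
    then obtain m n where x: "x \<in> carrier R" "\<forall>N. regular_maximal N \<longrightarrow> x \<notin> N \<longrightarrow> val N r \<le> enat m"
      and y: "y \<in> carrier R" "\<forall>N. regular_maximal N \<longrightarrow> y \<notin> N \<longrightarrow> val N r \<le> enat n"
      by (auto simp: U_def)
    have "val N r \<le> enat (max m n)" if N: "regular_maximal N" "x \<oplus> y \<notin> N" for N
    proof -
      have "x \<notin> N \<or> y \<notin> N"
        using N(2) additive_subgroup.a_closed[OF ideal.axioms(1)[OF regular_maximal_ideal[OF N(1)]]]
        by blast
      then have "val N r \<le> enat m \<or> val N r \<le> enat n" using x y N(1) by blast
      then show ?thesis by (auto elim: order_trans)
    qed
    then show "x \<oplus> y \<in> U" using x(1) y(1) by (auto simp: U_def)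
  next
    fix a x assume "a \<in> carrier R" "x \<in> U"
    moreover from this obtain n where "\<forall>N. regular_maximal N \<longrightarrow> x \<notin> N \<longrightarrow> val N r \<le> enat n"
      by (auto simp: U_def)
    ultimately show "a \<otimes> x \<in> U"
      using ideal.I_l_closed[OF regular_maximal_ideal] by (fastforce simp: U_def)
  qed
  have "val N r \<le> enat 0" if "regular_maximal N" "r \<notin> N" for N
    using val_eq_0_iff[OF that(1) Reg_closed[OF r]] that(2) by (simp add: zero_enat_def)
  then have "r \<in> U" using Reg_closed[OF r] by (auto simp: U_def)
  then have regU: "regular_ideal U R" using U r by (auto simp: regular_ideal_def)
  have "U = carrier R"
  proof (rule ccontr)
    assume "U \<noteq> carrier R"
    then obtain M where M: "regular_maximal M" "U \<subseteq> M" using ex_regular_maximal[OF regU] by blast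
    obtain n where n: "val M r = enat n" using val_Reg[OF M(1) r] by auto
    obtain u where "u \<in> carrier R - M"
      "\<forall>N. regular_maximal N \<longrightarrow> u \<notin> N \<longrightarrow> val N r \<le> val M r" using bound[OF M(1)] by blast
    then have "u \<in> U" "u \<notin> M" using n by (auto simp: U_def)
    then show False using M(2) by blast
  qed
  then have "\<one> \<in> U" by simp
  then obtain n where n: "\<forall>N. regular_maximal N \<longrightarrow> \<one> \<notin> N \<longrightarrow> val N r \<le> enat n"
    by (auto simp: U_def)
  have "V_pow R (Suc n) {r} = {}"
  proof -
    have "\<not> enat (Suc n) \<le> val N r" if N: "regular_maximal N" for N
    proof
      assume "enat (Suc n) \<le> val N r"
      also have "val N r \<le> enat n" using n N one_notin_regular_maximal[OF N] by blast
      finally show False by simp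
    qed
    then show ?thesis using V_pow_singleton[OF r, of "Suc n"] by simp
  qed
  then show ?thesis by (intro exI[of _ "Suc n"]) simp
qed

end


section \<open>The equivalences\<close>

theorem theorem2p12:
  fixes A :: "('a, 'b) ring_scheme"
  assumes "marot_ring A" and "N_ring A"
  shows "all_equivalent
    [ SP_ring A,

      \<forall>M. maximalideal M A \<and> regular_ideal M A \<longrightarrow>
        (\<exists>J \<subseteq> M. regular_ideal J A \<and> fin_gen_ideal J A \<and> radical_ideal J A),

      \<forall>I. regular_ideal I A \<and> fin_gen_ideal I A \<longrightarrow> fin_gen_ideal (ideal_radical A I) A,

      \<forall>x \<in> Reg A. product_of_radical_ideals (PIdl\<^bsub>A\<^esub> x) A,

      (\<forall>x \<in> Reg A. \<forall>n \<ge> 1. closedin (Zariski A) (V_pow A n {x})) \<and>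
      (\<forall>x \<in> Reg A. \<exists>m \<ge> 1. V_pow A m {x} = {}),

      (\<forall>I. regular_ideal I A \<and> I \<noteq> carrier A \<longrightarrow>
        (\<forall>n \<ge> 1. closedin (Zariski A) (V_pow A n I))) \<and>
      (\<forall>I. regular_ideal I A \<and> I \<noteq> carrier A \<longrightarrow> (\<exists>m \<ge> 1. V_pow A m I = {})),

      \<forall>I. regular_ideal I A \<and> I \<noteq> carrier A \<longrightarrow>
        (\<exists>Js. Js \<noteq> [] \<and> (\<forall>J \<in> set Js. radical_ideal J A) \<and>
          sorted_wrt (\<subseteq>) Js \<and> I = ideal_list_prod A Js),

      \<forall>I. regular_ideal I A \<and> I \<noteq> carrier A \<longrightarrow>
        (\<exists>!Js. Js \<noteq> [] \<and> (\<forall>J \<in> set Js. radical_ideal J A \<and> J \<noteq> carrier A) \<and>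
          sorted_wrt (\<subseteq>) Js \<and> I = ideal_list_prod A Js) ]"
    (is "all_equivalent [?i, ?ii, ?iii, ?iv, ?v, ?vi, ?vii, ?viii]")
proof -
  interpret marot_N_ring A by (rule marot_N_ring.intro[OF assms])
  have "?iv" if "?i"
    using SP_ring.regular_factorization[OF that] regular_ideal_cgenideal by blast
  moreover have "?v" if iv: "?iv"
  proof (intro conjI ballI allI impI)
    fix x assume x: "x \<in> Reg A"
    obtain Js where Js: "\<forall>J \<in> set Js. radical_ideal J A" "PIdl\<^bsub>A\<^esub> x = ideal_list_prod A Js"
      using iv x unfolding product_of_radical_ideals_def by blast
    note reg = regular_ideal_cgenideal[OF x]
    note V = V_pow_cgenideal[OF Reg_closed[OF x]]
    show "closedin (Zariski A) (V_pow A n {x})" if "1 \<le> n" for n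
      using closed_V_pow_list_prod[OF Js(1) reg Js(2) that] by (simp add: V)
    show "\<exists>m \<ge> 1. V_pow A m {x} = {}"
      using V_pow_list_prod_empty[OF Js(1) reg Js(2)]
      by (intro exI[of _ "Suc (length Js)"]) (simp add: V)
  qed
  moreover have "?vi" if v: "?v"
  proof (intro conjI allI impI)
    fix I assume I: "regular_ideal I A \<and> I \<noteq> carrier A"
    then have reg: "regular_ideal I A" by simp
    show "closedin (Zariski A) (V_pow A n I)" if "1 \<le> n" for n
      unfolding V_pow_eq_INT[OF reg]
      using v that regular_idealD[OF reg] by (intro closedin_INT) auto
    obtain x where x: "x \<in> I" "x \<in> Reg A" using regular_idealD[OF reg] by blast
    then obtain m where "1 \<le> m" "V_pow A m {x} = {}" using v by blast
    then show "\<exists>m \<ge> 1. V_pow A m I = {}"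
      using x unfolding V_pow_eq_INT[OF reg] by blast
  qed
  moreover have "?viii" if vi: "?vi"
  proof (intro allI impI)
    fix I assume I: "regular_ideal I A \<and> I \<noteq> carrier A"
    then obtain m where m: "V_pow A m I = {}" "1 \<le> m" using vi by blast
    have closed: "closedin (Zariski A) (V_pow A n I)" if "1 \<le> n" for n using vi I that by blast
    show "\<exists>!Js. Js \<noteq> [] \<and> (\<forall>J \<in> set Js. radical_ideal J A \<and> J \<noteq> carrier A) \<and>
        sorted_wrt (\<subseteq>) Js \<and> I = ideal_list_prod A Js"
    proof (rule ex_ex1I)
      show "\<exists>Js. Js \<noteq> [] \<and> (\<forall>J \<in> set Js. radical_ideal J A \<and> J \<noteq> carrier A) \<and>
          sorted_wrt (\<subseteq>) Js \<and> I = ideal_list_prod A Js"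
        using I closed m by (intro closed_V_pow_imp_chain_factorization) simp_all
    qed (use I chain_factorization_unique in simp)
  qed
  moreover have "?vii" if "?viii"
    using that by (meson ex1_implies_ex)
  moreover have "?i" if vii: "?vii"
  proof (intro SP_ring.intro SP_ring_axioms.intro is_cring)
    fix I assume I: "regular_ideal I A"
    \<comment> \<open>Chains are provided for proper ideals only; the unit ideal is itself radical.\<close>
    show "product_of_radical_ideals I A"
    proof (cases "I = carrier A")
      case True
      have "radical_ideal (carrier A) A"
        using oneideal by (auto simp: radical_ideal_def ideal_radical_def)
      moreover have "I = ideal_list_prod A [carrier A]"
        using True ideal_prod_one[OF oneideal] by (simp add: ideal_list_prod_def)
      ultimately show ?thesis
        unfolding product_of_radical_ideals_def by (intro exI[of _ "[carrier A]"]) simp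
    next
      case False
      then show ?thesis using vii I unfolding product_of_radical_ideals_def by blast
    qed
  qed
  moreover have "?iii" if vii: "?vii"
  proof (intro allI impI)
    fix I assume I: "regular_ideal I A \<and> fin_gen_ideal I A"
    show "fin_gen_ideal (ideal_radical A I) A"
    proof (cases "I = carrier A")
      case True
      then have "ideal_radical A I = I"
        using subset_ideal_radical[of I] by (auto simp: ideal_radical_def)
      then show ?thesis using I by simp
    next
      case False
      then obtain Js where "Js \<noteq> []" "\<forall>J \<in> set Js. radical_ideal J A" "sorted_wrt (\<subseteq>) Js"
        "I = ideal_list_prod A Js" using vii I by blast
      then show ?thesis using I radical_fin_gen by simp
    qed
  qed
  moreover have "?ii" if iii: "?iii"
  proof (intro allI impI)
    fix M assume M: "maximalideal M A \<and> regular_ideal M A"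
    then have max: "regular_maximal M" by (simp add: regular_maximal_def)
    obtain r where r: "r \<in> M" "r \<in> Reg A" using M regular_idealD by blast
    note rA = Reg_closed[OF r(2)]
    let ?J = "ideal_radical A (PIdl\<^bsub>A\<^esub> r)"
    have fg: "fin_gen_ideal ?J A"
      using iii regular_ideal_cgenideal[OF r(2)] fin_gen_cgenideal[OF rA] by blast
    note J = fin_gen_ideal_ideal[OF fg]
    note sub = ideal_subset[OF cgenideal_ideal[OF rA]]
    have "r \<in> ?J" using subset_ideal_radical[OF sub] cgenideal_self[OF rA] by blast
    then have "regular_ideal ?J A" using J r(2) by (auto simp: regular_ideal_def)
    moreover have "radical_ideal ?J A"
      using J ideal_radical_idem[OF sub] by (simp add: radical_ideal_def)
    moreover have "?J \<subseteq> M"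
    proof
      fix x assume "x \<in> ?J"
      then obtain n :: nat where n: "x \<in> carrier A" "x [^]\<^bsub>A\<^esub> n \<in> PIdl\<^bsub>A\<^esub> r"
        by (auto simp: ideal_radical_def)
      moreover have "PIdl\<^bsub>A\<^esub> r \<subseteq> M"
        by (rule cgenideal_minimal[OF regular_maximal_ideal[OF max] r(1)])
      ultimately show "x \<in> M" using prime_pow[OF regular_maximal_prime[OF max] n(1)] by blast
    qed
    ultimately show "\<exists>J \<subseteq> M. regular_ideal J A \<and> fin_gen_ideal J A \<and> radical_ideal J A"
      using fg by blast
  qed
  moreover have "?v" if ii: "?ii"
  proof -
    have bound: "\<exists>u \<in> carrier A - M. \<forall>N. regular_maximal N \<longrightarrow> u \<notin> N \<longrightarrow> val N r \<le> val M r"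
      if M: "regular_maximal M" and r: "r \<in> Reg A" for M r
    proof -
      obtain J where "J \<subseteq> M" "regular_ideal J A" "fin_gen_ideal J A" "radical_ideal J A"
        using ii M unfolding regular_maximal_def by blast
      then obtain u where "u \<in> carrier A - M"
        "\<And>N. regular_maximal N \<Longrightarrow> u \<notin> N \<Longrightarrow> val N r \<le> val M r"
        using local_bound[OF M r] by blast
      then show ?thesis by blast
    qed
    then show ?thesis using local_bounds_imp_closed local_bounds_imp_bounded by blast
  qed
  ultimately have "(?i \<longleftrightarrow> ?iv) \<and> (?iv \<longleftrightarrow> ?v) \<and> (?v \<longleftrightarrow> ?vi) \<and> (?vi \<longleftrightarrow> ?viii) \<and>
      (?viii \<longleftrightarrow> ?vii) \<and> (?vii \<longleftrightarrow> ?iii) \<and> (?iii \<longleftrightarrow> ?ii)"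
    by argo
  then show ?thesis unfolding all_equivalent_def by simp
qed

end
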